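(* Let $u_0\in L^\infty(M)$. There exists a unique solution $u\in C([0,\infty);L^\infty(M))$ of the Cauchy problem $$u_t-Lu=0\ \text{ in } M\times(0,\infty),\qquad u(x,0)=u_0(x)\ \text{ in } M.$$ Moreover, this solution satisfies $\|u\|_{L^\infty(M\times(0,\infty))}\le\|u_0\|_{L^\infty(M)}$.
   Context: $M$ is an $N$-dimensional Riemannian manifold without boundary, $O\in M$ is a fixed point, and there is a family of isometries $\tau_x:M\to M$, $x\in M$, with $\tau_x(x)=O$. $\mu$ is a measure on $M$ invariant under all the isometries $\tau_x$, and $L^p(M)=L^p(M,\mu)$. $s_{xy}$ denotes the geodesic distance between $x,y\in M$. $J:\mathbb{R}_{\ge0}\to\mathbb{R}_{\ge0}$ is a function normalized by $\int_M J(s_{xO})\,d\mu_x=1$. The operator $L$ is $$Lu(x)=\int_M J(s_{xy})u(y)\,d\mu_y-u(x).$$ Being a solution of the Cauchy problem is equivalent to satisfying, for all $t\geq 0$, $$u(x,t)=e^{-t}u_0(x)+\int_0^t\int_M e^{-(t-r)}J(s_{xy})u(y,r)\,d\mu_y\,dr .$$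
   Formalization: The measure μ is assumed to be a σ-finite Borel measure (without σ-finiteness Lu may fail to be measurable and the product measure on M×(0,∞) is ambiguous); M is taken connected so that the geodesic distance is finite, and J is taken Borel measurable. *)

theory Defs
  imports "HOL-Analysis.Analysis" "HOL-Probability.Essential_Supremum"
begin

section \<open>Riemannian manifolds\<close>

text \<open>The predicates below are meant for open sets S, so that the two-sided derivative is
  the right one. A function is \<open>C\<^sup>k\<^sup>+\<^sup>1\<close> iff it is differentiable and
  all its directional derivatives are \<open>C\<^sup>k\<close>.\<close>

primrec Ck_on :: "nat \<Rightarrow> 'a::euclidean_space set \<Rightarrow> ('a \<Rightarrow> 'b::real_normed_vector) \<Rightarrow> bool" where
  "Ck_on 0 S f \<longleftrightarrow> continuous_on S f"
| "Ck_on (Suc k) S f \<longleftrightarrow>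
     (\<forall>x\<in>S. f differentiable (at x)) \<and> (\<forall>v. Ck_on k S (\<lambda>x. frechet_derivative f (at x) v))"

definition smooth_on :: "'a::euclidean_space set \<Rightarrow> ('a \<Rightarrow> 'b::real_normed_vector) \<Rightarrow> bool" where
  "smooth_on S f \<longleftrightarrow> (\<forall>k. Ck_on k S f)"

text \<open>A chart (U, \<open>\<phi>\<close>) has domain U; the values of \<open>\<phi>\<close> outside U are
  irrelevant. The model space is a Euclidean space \<open>'e\<close>, so the dimension N of the manifold
  is DIM(\<open>'e\<close>). The manifold itself is the whole type \<open>'m\<close>.\<close>

type_synonym ('m, 'e) chart = "'m set \<times> ('m \<Rightarrow> 'e)"

definition is_chart :: "('m::topological_space, 'e::euclidean_space) chart \<Rightarrow> bool" where
  "is_chart = (\<lambda>(U, \<phi>). open U \<and> open (\<phi> ` U) \<and> homeomorphism U (\<phi> ` U) \<phi> (inv_into U \<phi>))"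

definition smooth_atlas :: "('m::topological_space, 'e::euclidean_space) chart set \<Rightarrow> bool" where
  "smooth_atlas A \<longleftrightarrow>
     (\<forall>c\<in>A. is_chart c) \<and> \<Union> (fst ` A) = UNIV \<and>
     (\<forall>(U, \<phi>)\<in>A. \<forall>(V, \<psi>)\<in>A. smooth_on (\<phi> ` (U \<inter> V)) (\<psi> \<circ> inv_into U \<phi>))"

text \<open>A metric tensor is given by its coordinate expressions: g c p is the inner product of
  the tangent space at p, transported to \<open>'e\<close> by the chart c.\<close>

type_synonym ('m, 'e) metric_tensor = "('m, 'e) chart \<Rightarrow> 'm \<Rightarrow> 'e \<Rightarrow> 'e \<Rightarrow> real"

definition riemannian_metric ::
  "('m::topological_space, 'e::euclidean_space) chart set \<Rightarrow> ('m, 'e) metric_tensor \<Rightarrow> bool" where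
  "riemannian_metric A g \<longleftrightarrow>
     (\<forall>(U, \<phi>)\<in>A. \<forall>p\<in>U.
        bilinear (g (U, \<phi>) p) \<and>
        (\<forall>v w. g (U, \<phi>) p v w = g (U, \<phi>) p w v) \<and>
        (\<forall>v. v \<noteq> 0 \<longrightarrow> g (U, \<phi>) p v v > 0)) \<and>
     (\<forall>(U, \<phi>)\<in>A. \<forall>v w. smooth_on (\<phi> ` U) (\<lambda>x. g (U, \<phi>) (inv_into U \<phi> x) v w)) \<and>
     (\<forall>(U, \<phi>)\<in>A. \<forall>(V, \<psi>)\<in>A. \<forall>p\<in>U \<inter> V. \<forall>v w.
        g (U, \<phi>) p v w =
        g (V, \<psi>) p (frechet_derivative (\<psi> \<circ> inv_into U \<phi>) (at (\<phi> p)) v)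
                    (frechet_derivative (\<psi> \<circ> inv_into U \<phi>) (at (\<phi> p)) w))"

text \<open>Hausdorffness and second countability are in the sort of \<open>'m\<close>. Connectedness makes the
  geodesic distance finite.\<close>

definition riemannian_manifold ::
  "('m::{t2_space, second_countable_topology}, 'e::euclidean_space) chart set
    \<Rightarrow> ('m, 'e) metric_tensor \<Rightarrow> bool" where
  "riemannian_manifold A g \<longleftrightarrow>
     smooth_atlas A \<and> connected (UNIV :: 'm set) \<and> riemannian_metric A g"

definition smooth_map ::
  "('m::topological_space, 'e::euclidean_space) chart set \<Rightarrow> ('m \<Rightarrow> 'm) \<Rightarrow> bool" where
  "smooth_map A f \<longleftrightarrow>
     continuous_on UNIV f \<and>
     (\<forall>(U, \<phi>)\<in>A. \<forall>(V, \<psi>)\<in>A. smooth_on (\<phi> ` (U \<inter> f -` V)) (\<psi> \<circ> f \<circ> inv_into U \<phi>))"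

definition isometry ::
  "('m::topological_space, 'e::euclidean_space) chart set \<Rightarrow> ('m, 'e) metric_tensor
    \<Rightarrow> ('m \<Rightarrow> 'm) \<Rightarrow> bool" where
  "isometry A g f \<longleftrightarrow>
     bij f \<and> smooth_map A f \<and> smooth_map A (inv f) \<and>
     (\<forall>(U, \<phi>)\<in>A. \<forall>(V, \<psi>)\<in>A. \<forall>p\<in>U \<inter> f -` V. \<forall>v w.
        g (U, \<phi>) p v w =
        g (V, \<psi>) (f p) (frechet_derivative (\<psi> \<circ> f \<circ> inv_into U \<phi>) (at (\<phi> p)) v)
                        (frechet_derivative (\<psi> \<circ> f \<circ> inv_into U \<phi>) (at (\<phi> p)) w))"

subsection \<open>Geodesic distance\<close>

text \<open>Curves are parametrized by the unit interval. As in the library's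
  \<open>piecewise_C1_differentiable_on\<close>, they are continuous, and \<open>C\<^sup>1\<close> off a finite
  set.\<close>

definition piecewise_C1_curve ::
  "('m::topological_space, 'e::euclidean_space) chart set \<Rightarrow> (real \<Rightarrow> 'm) \<Rightarrow> bool" where
  "piecewise_C1_curve A \<gamma> \<longleftrightarrow>
     path \<gamma> \<and>
     (\<exists>F. finite F \<and>
        (\<forall>(U, \<phi>)\<in>A. (\<phi> \<circ> \<gamma>) C1_differentiable_on (({0<..<1} - F) \<inter> \<gamma> -` U)))"

text \<open>The choice of the chart around \<open>\<gamma> t\<close> does not matter, by the transformation rule for
  the metric tensor.\<close>

definition speed ::
  "('m, 'e::euclidean_space) chart set \<Rightarrow> ('m, 'e) metric_tensor
    \<Rightarrow> (real \<Rightarrow> 'm) \<Rightarrow> real \<Rightarrow> real" where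
  "speed A g \<gamma> t =
     (let c = (SOME c. c \<in> A \<and> \<gamma> t \<in> fst c);
          v = vector_derivative (snd c \<circ> \<gamma>) (at t)
      in sqrt (g c (\<gamma> t) v v))"

definition curve_length ::
  "('m, 'e::euclidean_space) chart set \<Rightarrow> ('m, 'e) metric_tensor \<Rightarrow> (real \<Rightarrow> 'm) \<Rightarrow> ennreal" where
  "curve_length A g \<gamma> = (\<integral>\<^sup>+t\<in>{0..1}. ennreal (speed A g \<gamma> t) \<partial>lborel)"

definition geodesic_dist ::
  "('m::topological_space, 'e::euclidean_space) chart set \<Rightarrow> ('m, 'e) metric_tensor
    \<Rightarrow> 'm \<Rightarrow> 'm \<Rightarrow> real" where
  "geodesic_dist A g x y =
     enn2real (INF \<gamma>\<in>{\<gamma>. piecewise_C1_curve A \<gamma> \<and> pathstart \<gamma> = x \<and> pathfinish \<gamma> = y}.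
       curve_length A g \<gamma>)"

section \<open>The space of essentially bounded functions\<close>

text \<open>Elements are represented by measurable functions; equality is equality almost everywhere.
  The norm is infinite for a function that is not measurable, even if its absolute value is.\<close>

definition Linf_norm :: "'a measure \<Rightarrow> ('a \<Rightarrow> real) \<Rightarrow> ereal" where
  "Linf_norm M f = (if f \<in> borel_measurable M then esssup M (\<lambda>x. ereal \<bar>f x\<bar>) else \<infinity>)"

definition Linf :: "'a measure \<Rightarrow> ('a \<Rightarrow> real) set" where
  "Linf M = {f \<in> borel_measurable M. Linf_norm M f < \<infinity>}"

text \<open>\<open>u \<in> C([0,\<infinity>); L\<^sup>\<infinity>(M))\<close>; the values of u at negative times are irrelevant.\<close>

definition continuous_Linf :: "'a measure \<Rightarrow> (real \<Rightarrow> 'a \<Rightarrow> real) \<Rightarrow> bool" where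
  "continuous_Linf M u \<longleftrightarrow>
     (\<forall>t\<ge>0. u t \<in> Linf M) \<and>
     (\<forall>t\<ge>0. ((\<lambda>s. Linf_norm M (\<lambda>x. u s x - u t x)) \<longlongrightarrow> 0) (at t within {0..}))"

definition has_Linf_derivative ::
  "'a measure \<Rightarrow> (real \<Rightarrow> 'a \<Rightarrow> real) \<Rightarrow> ('a \<Rightarrow> real) \<Rightarrow> real \<Rightarrow> bool" where
  "has_Linf_derivative M u w t \<longleftrightarrow>
     ((\<lambda>s. Linf_norm M (\<lambda>x. (u s x - u t x) / (s - t) - w x)) \<longlongrightarrow> 0) (at t)"

section \<open>The Cauchy problem\<close>

definition nonlocal_op ::
  "'m measure \<Rightarrow> ('m \<Rightarrow> 'm \<Rightarrow> real) \<Rightarrow> (real \<Rightarrow> real) \<Rightarrow> ('m \<Rightarrow> real) \<Rightarrow> 'm \<Rightarrow> real" where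
  "nonlocal_op \<mu> s J u x = (LINT y|\<mu>. J (s x y) * u y) - u x"

text \<open>The time derivative is taken in \<open>L\<^sup>\<infinity>(M)\<close>.\<close>

definition cauchy_solution ::
  "'m measure \<Rightarrow> ('m \<Rightarrow> 'm \<Rightarrow> real) \<Rightarrow> (real \<Rightarrow> real) \<Rightarrow> ('m \<Rightarrow> real)
    \<Rightarrow> (real \<Rightarrow> 'm \<Rightarrow> real) \<Rightarrow> bool" where
  "cauchy_solution \<mu> s J u\<^sub>0 u \<longleftrightarrow>
     continuous_Linf \<mu> u \<and>
     (\<forall>t>0. has_Linf_derivative \<mu> u (nonlocal_op \<mu> s J (u t)) t) \<and>
     (AE x in \<mu>. u 0 x = u\<^sub>0 x)"

end

theory Submission
  imports Defs
begin

text \<open>Since the isometries \<open>\<tau>\<^sub>x\<close> preserve \<open>\<mu>\<close> and the geodesic distance, the kernel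
  \<open>J(s\<^sub>x\<^sub>y)\<close> has total mass 1 in y for every x. So averaging against the kernel, written P below,
  is a contraction of \<open>L\<^sup>\<infinity>\<close>, and \<open>L = P - 1\<close> generates the explicit solution
  \<open>u(t) = e\<^sup>-\<^sup>t \<Sum>\<^sub>k t\<^sup>k/k! P\<^sup>k u\<^sub>0\<close>, a Poisson average of the functions \<open>P\<^sup>k u\<^sub>0\<close>; this
  gives the bound. The norm of the difference of two solutions grows at most at rate 2, so it stays
  below every barrier \<open>\<epsilon> e\<^sup>3\<^sup>t\<close>. That the kernel is jointly measurable follows from the upper
  semicontinuity of the geodesic distance, for which the triangle inequality and an upper bound in a
  chart suffice.\<close>

section \<open>Lower integrals\<close>

text \<open>Elements of \<open>Linf\<close> are functions, not classes, and the initial value is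
  bounded only almost everywhere. It is therefore replaced by a representative bounded by
  \<open>B\<close> at every point. Then the series converges at every point, and estimates in
  \<open>Linf\<close> reduce to estimates for a scalar sequence with
  \<open>\<bar>a k\<bar> \<le> B\<close>, uniform in the point; continuity and the derivative in
  norm follow with the explicit constants \<open>2 * B\<close> and \<open>4 * B\<close>. The rate 2
  is the sum of the bounds 1 for P and 1 for the identity; 3 stands for any larger number. A barrier
  is used because the norm of a difference of solutions is continuous but need not be
  differentiable: the equation only yields one-sided growth estimates for it. Distances are
  estimated in \<open>ennreal\<close>, before \<open>enn2real\<close> turns infinity into 0.\<close>

text \<open>\<^const>\<open>nn_integral\<close> of a non-measurable function is its lower integral. The next two
  inequalities hold for it without measurability, so that the speed of a curve need not be shown
  to be measurable.\<close>

lemma nn_integral_le_simple: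
  assumes "\<And>s. simple_function M s \<Longrightarrow> s \<le> f \<Longrightarrow> integral\<^sup>N M s \<le> C"
  shows "integral\<^sup>N M f \<le> C"
  unfolding nn_integral_def[of M f]
proof (rule SUP_least)
  fix s assume "s \<in> {s. simple_function M s \<and> s \<le> f}"
  then show "integral\<^sup>S M s \<le> C"
    using assms[of s] nn_integral_eq_simple_integral[of M s] by simp
qed

lemma nn_integral_split_le:
  assumes "A \<in> sets M"
  shows "integral\<^sup>N M f \<le> (\<integral>\<^sup>+x. f x * indicator A x \<partial>M) + (\<integral>\<^sup>+x. f x * indicator (- A) x \<partial>M)"
proof (rule nn_integral_le_simple)
  fix s assume s: "simple_function M s" "s \<le> f"
  have "s \<in> borel_measurable M"
    by (rule borel_measurable_simple_function[OF s(1)])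
  note [simp] = this
  have "integral\<^sup>N M s = (\<integral>\<^sup>+x. s x * indicator A x + s x * indicator (space M - A) x \<partial>M)"
    by (intro nn_integral_cong) (auto split: split_indicator)
  also have "\<dots> = (\<integral>\<^sup>+x. s x * indicator A x \<partial>M) + (\<integral>\<^sup>+x. s x * indicator (space M - A) x \<partial>M)"
    using assms by (intro nn_integral_add borel_measurable_times_ennreal borel_measurable_indicator) auto
  also have "\<dots> \<le> (\<integral>\<^sup>+x. f x * indicator A x \<partial>M) + (\<integral>\<^sup>+x. f x * indicator (- A) x \<partial>M)"
    using s(2) by (intro add_mono nn_integral_mono) (auto simp: le_fun_def split: split_indicator)
  finally show "integral\<^sup>N M s \<le> \<dots>" .
qed

lemma nn_integral_real_affine_le:
  fixes c :: real
  assumes "c \<noteq> 0"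
  shows "(\<integral>\<^sup>+x. f x \<partial>lborel) \<le> (\<integral>\<^sup>+x. ennreal \<bar>c\<bar> * f (t + c * x) \<partial>lborel)"
proof (rule nn_integral_le_simple)
  fix s assume s: "simple_function lborel s" "s \<le> f"
  have [measurable]: "s \<in> borel_measurable borel"
    using borel_measurable_simple_function[OF s(1)] by simp
  have "integral\<^sup>N lborel s = (\<integral>\<^sup>+x. ennreal \<bar>c\<bar> * s (t + c * x) \<partial>lborel)"
    using nn_integral_real_affine[of s c t] assms by (simp add: nn_integral_cmult)
  also have "\<dots> \<le> (\<integral>\<^sup>+x. ennreal \<bar>c\<bar> * f (t + c * x) \<partial>lborel)"
    using s(2) by (intro nn_integral_mono mult_left_mono) (auto simp: le_fun_def)
  finally show "integral\<^sup>N lborel s \<le> \<dots>" .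
qed

section \<open>Calculus\<close>

text \<open>The derivative at \<open>t\<close>, and its continuity within \<open>S\<close>, depend
  only on values near \<open>t\<close>. This is needed because a coordinate expression of a curve
  can be rewritten through another chart only while the curve stays in both domains.\<close>

lemma C1_differentiable_on_local:
  fixes f :: "real \<Rightarrow> 'b::real_normed_vector"
  assumes "\<And>t. t \<in> S \<Longrightarrow> \<exists>T h. open T \<and> t \<in> T \<and> h C1_differentiable_on (S \<inter> T) \<and> (\<forall>s\<in>T. h s = f s)"
  shows "f C1_differentiable_on S"
  unfolding C1_differentiable_on_eq continuous_on_eq_continuous_within
proof (intro conjI ballI)
  fix t assume "t \<in> S"
  from assms[OF this] obtain T h where
    Th: "open T \<and> t \<in> T \<and> h C1_differentiable_on (S \<inter> T) \<and> (\<forall>s\<in>T. h s = f s)"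
    by (elim exE)
  then have T: "open T" "t \<in> T" "h C1_differentiable_on (S \<inter> T)"
    by simp_all
  have deriv: "(f has_vector_derivative vector_derivative h (at s)) (at s)" if s: "s \<in> S \<inter> T" for s
  proof (rule has_vector_derivative_transform_within_open[where S = T])
    show "(h has_vector_derivative vector_derivative h (at s)) (at s)"
      using T(3) s unfolding C1_differentiable_on_eq by (simp add: vector_derivative_works)
  qed (use Th s in simp_all)
  then show "f differentiable at t"
    using \<open>t \<in> S\<close> T(2) differentiableI_vector by blast
  have "continuous (at t within S \<inter> T) (\<lambda>s. vector_derivative h (at s))"
    using T \<open>t \<in> S\<close> unfolding C1_differentiable_on_eq continuous_on_eq_continuous_within by simp
  then have "continuous (at t within S \<inter> T) (\<lambda>s. vector_derivative f (at s))"
    by (rule continuous_transform_within[where \<delta> = 1])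
      (use T(2) \<open>t \<in> S\<close> in \<open>simp_all add: vector_derivative_at[OF deriv]\<close>)
  moreover have "at t within S \<inter> T = at t within S"
    using T by (intro at_within_nhd[of t T]) auto
  ultimately show "continuous (at t within S) (\<lambda>s. vector_derivative f (at s))"
    by simp
qed

lemma smooth_on_D:
  assumes "smooth_on S f"
  shows "continuous_on S f"
    and "x \<in> S \<Longrightarrow> f differentiable (at x)"
    and "continuous_on S (\<lambda>x. frechet_derivative f (at x) v)"
proof -
  show "continuous_on S f"
    using assms[unfolded smooth_on_def, rule_format, of 0] by simp
  show "x \<in> S \<Longrightarrow> f differentiable (at x)" "continuous_on S (\<lambda>x. frechet_derivative f (at x) v)"
    using assms[unfolded smooth_on_def, rule_format, of "Suc 0"] by simp_all
qed

lemma differentiable_compose_vector_derivative: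
  assumes "(c has_vector_derivative v) (at t)" "h differentiable (at (c t))"
  shows "((h \<circ> c) has_vector_derivative frechet_derivative h (at (c t)) v) (at t)"
  by (rule vector_derivative_diff_chain_within[OF assms(1) has_derivative_at_withinI])
    (rule assms(2)[unfolded frechet_derivative_works])

text \<open>\<open>Ck_on\<close> gives continuity of the derivative in each fixed direction, whereas
  the velocity \<open>D t\<close> varies. Expanding it in the finite basis reduces to fixed
  directions.\<close>

lemma smooth_on_compose_C1:
  fixes h :: "'a::euclidean_space \<Rightarrow> 'b::real_normed_vector"
  assumes h: "smooth_on S h" and c: "c C1_differentiable_on T" and sub: "c ` T \<subseteq> S"
  shows "(h \<circ> c) C1_differentiable_on T"
proof -
  obtain D where D: "\<And>t. t \<in> T \<Longrightarrow> (c has_vector_derivative D t) (at t)" "continuous_on T D"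
    using c unfolding C1_differentiable_on_def by blast
  have cont: "continuous_on T c"
    using has_vector_derivative_continuous[OF D(1)] by (intro continuous_at_imp_continuous_on) simp
  have diff: "h differentiable (at (c t))" if "t \<in> T" for t
    using that sub by (intro smooth_on_D(2)[OF h]) auto
  have "continuous_on T (\<lambda>t. frechet_derivative h (at (c t)) b)" for b
    by (rule continuous_on_compose2[OF smooth_on_D(3)[OF h] cont sub])
  then have sum_cont: "continuous_on T (\<lambda>t. \<Sum>b\<in>Basis. (D t \<bullet> b) *\<^sub>R frechet_derivative h (at (c t)) b)"
    by (intro continuous_on_sum continuous_on_scaleR continuous_on_inner continuous_on_const D(2))
  have "frechet_derivative h (at (c t)) (D t)
      = (\<Sum>b\<in>Basis. (D t \<bullet> b) *\<^sub>R frechet_derivative h (at (c t)) b)" if "t \<in> T" for t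
  proof -
    have lin: "linear (frechet_derivative h (at (c t)))"
      by (rule linear_frechet_derivative[OF diff[OF that]])
    have "frechet_derivative h (at (c t)) (\<Sum>b\<in>Basis. (D t \<bullet> b) *\<^sub>R b)
        = (\<Sum>b\<in>Basis. (D t \<bullet> b) *\<^sub>R frechet_derivative h (at (c t)) b)"
      by (simp only: linear_sum[OF lin] linear_scale[OF lin])
    then show ?thesis
      by (simp only: euclidean_representation)
  qed
  then have "continuous_on T (\<lambda>t. frechet_derivative h (at (c t)) (D t))"
    by (intro continuous_on_eq[OF sum_cont]) simp
  moreover have "((h \<circ> c) has_vector_derivative frechet_derivative h (at (c t)) (D t)) (at t)"
    if "t \<in> T" for t
    by (intro differentiable_compose_vector_derivative D(1) diff that)
  ultimately show ?thesis
    unfolding C1_differentiable_on_def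
    by (intro exI[of _ "\<lambda>t. frechet_derivative h (at (c t)) (D t)"]) simp
qed

text \<open>The constant is built from matrix entries because the metric tensor is known to be
  smooth entry by entry; the constant is then continuous in the base point.\<close>

lemma bilinear_norm_bound:
  fixes h :: "'a::euclidean_space \<Rightarrow> 'a \<Rightarrow> real"
  assumes "bilinear h"
  shows "\<bar>h w w\<bar> \<le> (\<Sum>(i, j)\<in>Basis \<times> Basis. \<bar>h i j\<bar>) * (norm w)\<^sup>2"
proof -
  have "h w w = h (\<Sum>i\<in>Basis. (w \<bullet> i) *\<^sub>R i) (\<Sum>i\<in>Basis. (w \<bullet> i) *\<^sub>R i)"
    by (simp add: euclidean_representation)
  also have "\<dots> = (\<Sum>(i, j)\<in>Basis \<times> Basis. (w \<bullet> i) * (w \<bullet> j) * h i j)"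
    using assms by (simp add: bilinear_sum bilinear_lmul bilinear_rmul mult.assoc)
  finally have "\<bar>h w w\<bar> \<le> (\<Sum>(i, j)\<in>Basis \<times> Basis. \<bar>(w \<bullet> i) * (w \<bullet> j) * h i j\<bar>)"
    by (simp add: case_prod_beta sum_abs)
  also have "\<dots> \<le> (\<Sum>(i, j)\<in>Basis \<times> Basis. \<bar>h i j\<bar> * (norm w)\<^sup>2)"
  proof (rule sum_mono, clarify)
    fix i j :: 'a assume "i \<in> Basis" "j \<in> Basis"
    then have "\<bar>w \<bullet> i\<bar> * \<bar>w \<bullet> j\<bar> \<le> norm w * norm w"
      by (intro mult_mono Basis_le_norm) auto
    then show "\<bar>(w \<bullet> i) * (w \<bullet> j) * h i j\<bar> \<le> \<bar>h i j\<bar> * (norm w)\<^sup>2"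
      by (simp add: abs_mult power2_eq_square mult.commute mult_left_mono)
  qed
  also have "\<dots> = (\<Sum>(i, j)\<in>Basis \<times> Basis. \<bar>h i j\<bar>) * (norm w)\<^sup>2"
    by (simp add: sum_distrib_right case_prod_beta)
  finally show ?thesis .
qed

section \<open>The geodesic distance\<close>

locale riemannian =
  fixes A :: "('m::{t2_space, second_countable_topology}, 'e::euclidean_space) chart set"
    and g :: "('m, 'e) metric_tensor"
  assumes riemannian_manifold: "riemannian_manifold A g"
begin

section \<open>Charts, curves and their images under smooth maps\<close>

lemma atlas: "smooth_atlas A" and metric: "riemannian_metric A g"
  using riemannian_manifold unfolding riemannian_manifold_def by auto

lemma chart_at:
  obtains U \<phi> where "(U, \<phi>) \<in> A" "p \<in> U"
proof -
  have "p \<in> \<Union> (fst ` A)" using atlas unfolding smooth_atlas_def by simp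
  then show thesis using that by force
qed

lemma chart:
  assumes "(U, \<phi>) \<in> A"
  shows "open U" "open (\<phi> ` U)" "continuous_on U \<phi>" "continuous_on (\<phi> ` U) (inv_into U \<phi>)"
    and "p \<in> U \<Longrightarrow> inv_into U \<phi> (\<phi> p) = p" and "y \<in> \<phi> ` U \<Longrightarrow> inv_into U \<phi> y \<in> U"
  using assms atlas unfolding smooth_atlas_def is_chart_def homeomorphism_def
  by (auto simp: inv_into_into)

text \<open>The exceptional set is made a parameter so that it can be followed through composition,
  reversal and concatenation.\<close>

definition C1_off :: "real set \<Rightarrow> (real \<Rightarrow> 'm) \<Rightarrow> bool" where
  "C1_off F \<gamma> \<longleftrightarrow> path \<gamma> \<and> finite F \<and>
     (\<forall>(U, \<phi>)\<in>A. (\<phi> \<circ> \<gamma>) C1_differentiable_on (({0<..<1} - F) \<inter> \<gamma> -` U))"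

lemma piecewise_C1_curve_C1_off: "piecewise_C1_curve A \<gamma> \<longleftrightarrow> (\<exists>F. C1_off F \<gamma>)"
  unfolding piecewise_C1_curve_def C1_off_def by blast

lemma path_open_vimage:
  assumes "path \<gamma>" "open W"
  shows "open ({0<..<1} \<inter> \<gamma> -` W)"
proof -
  have "continuous_on {0<..<1} \<gamma>"
    using assms(1) unfolding path_def by (rule continuous_on_subset) auto
  then show ?thesis
    using assms(2) continuous_on_open_vimage[of "{0<..<1}" \<gamma>] by (simp add: Int_commute)
qed

lemma C1_off_velocity:
  assumes "C1_off F \<gamma>" "t \<in> {0<..<1} - F"
  obtains U \<phi> v where "(U, \<phi>) \<in> A" "\<gamma> t \<in> U" "((\<phi> \<circ> \<gamma>) has_vector_derivative v) (at t)"
proof -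
  obtain U \<phi> where U: "(U, \<phi>) \<in> A" "\<gamma> t \<in> U" using chart_at .
  then have "(\<phi> \<circ> \<gamma>) C1_differentiable_on (({0<..<1} - F) \<inter> \<gamma> -` U)"
    using assms(1) unfolding C1_off_def by auto
  then obtain v where "((\<phi> \<circ> \<gamma>) has_vector_derivative v) (at t)"
    using assms(2) U(2) unfolding C1_differentiable_on_def by blast
  with U show thesis using that by blast
qed

lemma smooth_map_continuous: "smooth_map A f \<Longrightarrow> continuous_on UNIV f"
  unfolding smooth_map_def by simp

lemma smooth_map_open_vimage: "smooth_map A f \<Longrightarrow> open V \<Longrightarrow> open (f -` V)"
  using smooth_map_continuous by (simp add: continuous_on_open_vimage[OF open_UNIV])

text \<open>Near each parameter the curve stays in one chart \<open>U\<close>, and the new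
  coordinates are the smooth local expression \<open>h\<close> of \<open>f\<close> applied to the
  old ones. No new exceptional points arise.\<close>

lemma C1_off_compose:
  assumes \<gamma>: "C1_off F \<gamma>" and f: "smooth_map A f"
  shows "C1_off F (f \<circ> \<gamma>)"
proof -
  have "(\<psi> \<circ> (f \<circ> \<gamma>)) C1_differentiable_on (({0<..<1} - F) \<inter> (f \<circ> \<gamma>) -` V)"
    if V: "(V, \<psi>) \<in> A" for V \<psi>
  proof (rule C1_differentiable_on_local)
    fix t assume t: "t \<in> ({0<..<1} - F) \<inter> (f \<circ> \<gamma>) -` V"
    obtain U \<phi> where U: "(U, \<phi>) \<in> A" "\<gamma> t \<in> U" using chart_at .
    define h where "h = \<psi> \<circ> f \<circ> inv_into U \<phi>"
    define T where "T = {0<..<1} \<inter> \<gamma> -` (U \<inter> f -` V)"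
    have "open T"
      unfolding T_def using \<gamma> chart(1)[OF U(1)] smooth_map_open_vimage[OF f chart(1)[OF V]]
      by (intro path_open_vimage open_Int) (auto simp: C1_off_def)
    moreover have "t \<in> T"
      using t U unfolding T_def by auto
    moreover have "(h \<circ> (\<phi> \<circ> \<gamma>)) C1_differentiable_on (({0<..<1} - F) \<inter> (f \<circ> \<gamma>) -` V \<inter> T)"
    proof (rule smooth_on_compose_C1)
      show "smooth_on (\<phi> ` (U \<inter> f -` V)) h"
        using f U(1) V unfolding smooth_map_def h_def by blast
      have "(\<phi> \<circ> \<gamma>) C1_differentiable_on (({0<..<1} - F) \<inter> \<gamma> -` U)"
        using \<gamma> U(1) unfolding C1_off_def by blast
      then show "(\<phi> \<circ> \<gamma>) C1_differentiable_on (({0<..<1} - F) \<inter> (f \<circ> \<gamma>) -` V \<inter> T)"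
        by (rule C1_differentiable_on_subset) (auto simp: T_def)
    qed (auto simp: T_def)
    moreover have "\<forall>s\<in>T. (h \<circ> (\<phi> \<circ> \<gamma>)) s = (\<psi> \<circ> (f \<circ> \<gamma>)) s"
      using chart(5)[OF U(1)] unfolding h_def T_def by auto
    ultimately show "\<exists>T h. open T \<and> t \<in> T \<and>
        h C1_differentiable_on (({0<..<1} - F) \<inter> (f \<circ> \<gamma>) -` V \<inter> T) \<and> (\<forall>s\<in>T. h s = (\<psi> \<circ> (f \<circ> \<gamma>)) s)"
      by blast
  qed
  then show ?thesis
    using \<gamma> path_continuous_image[of \<gamma> f] smooth_map_continuous[OF f]
    unfolding C1_off_def by (auto intro: continuous_on_subset)
qed

section \<open>Invariance of speed and length under isometries\<close>

lemma isometry_metric: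
  assumes "isometry A g f" "(U, \<phi>) \<in> A" "(V, \<psi>) \<in> A" "p \<in> U" "f p \<in> V"
  shows "g (U, \<phi>) p v w =
    g (V, \<psi>) (f p) (frechet_derivative (\<psi> \<circ> f \<circ> inv_into U \<phi>) (at (\<phi> p)) v)
                   (frechet_derivative (\<psi> \<circ> f \<circ> inv_into U \<phi>) (at (\<phi> p)) w)"
proof -
  have "\<forall>p\<in>U \<inter> f -` V. \<forall>v w. g (U, \<phi>) p v w =
    g (V, \<psi>) (f p) (frechet_derivative (\<psi> \<circ> f \<circ> inv_into U \<phi>) (at (\<phi> p)) v)
                   (frechet_derivative (\<psi> \<circ> f \<circ> inv_into U \<phi>) (at (\<phi> p)) w)"
    using assms(1)[unfolded isometry_def, THEN conjunct2, THEN conjunct2, THEN conjunct2,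
        THEN bspec, OF assms(2), unfolded prod.case, THEN bspec, OF assms(3), unfolded prod.case] .
  then show ?thesis using assms(4,5) by blast
qed

text \<open>\<open>speed\<close> uses a chart chosen by \<open>SOME\<close>; here the value is
  computed in an arbitrary chart at \<open>\<gamma> t\<close>. The chain rule carries
  \<open>v\<close> to the chosen chart, and the isometry condition carries the inner product back.
  Continuity near \<open>t\<close> keeps the curve in both chart domains.\<close>

lemma speed_compose:
  assumes f: "isometry A g f" and U: "(U, \<phi>) \<in> A" "\<gamma> t \<in> U"
    and T: "open T" "t \<in> T" "continuous_on T \<gamma>"
    and v: "((\<phi> \<circ> \<gamma>) has_vector_derivative v) (at t)"
  shows "speed A g (f \<circ> \<gamma>) t = sqrt (g (U, \<phi>) (\<gamma> t) v v)"
proof -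
  obtain V \<psi> where c: "(SOME c. c \<in> A \<and> (f \<circ> \<gamma>) t \<in> fst c) = (V, \<psi>)"
    by fastforce
  obtain c where "c \<in> A \<and> (f \<circ> \<gamma>) t \<in> fst c"
    using chart_at[of "(f \<circ> \<gamma>) t"] by (metis fst_conv)
  then have "(V, \<psi>) \<in> A \<and> (f \<circ> \<gamma>) t \<in> fst (V, \<psi>)"
    unfolding c[symmetric] by (rule someI)
  then have V: "(V, \<psi>) \<in> A" "f (\<gamma> t) \<in> V" by auto
  have sm: "smooth_map A f" using f unfolding isometry_def by simp
  define h where "h = \<psi> \<circ> f \<circ> inv_into U \<phi>"
  have h: "smooth_on (\<phi> ` (U \<inter> f -` V)) h"
    using sm U(1) V(1) unfolding smooth_map_def h_def by blast
  then have "h differentiable (at (\<phi> (\<gamma> t)))"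
    using U V by (intro smooth_on_D(2)) auto
  then have "((h \<circ> (\<phi> \<circ> \<gamma>)) has_vector_derivative frechet_derivative h (at (\<phi> (\<gamma> t))) v) (at t)"
    using differentiable_compose_vector_derivative[OF v] by simp
  moreover have "open (\<gamma> -` (U \<inter> f -` V) \<inter> T)"
    using T chart(1)[OF U(1)] smooth_map_open_vimage[OF sm chart(1)[OF V(1)]]
      continuous_on_open_vimage[OF T(1), of \<gamma>] by blast
  ultimately have "((\<psi> \<circ> (f \<circ> \<gamma>)) has_vector_derivative frechet_derivative h (at (\<phi> (\<gamma> t))) v) (at t)"
    by (rule has_vector_derivative_transform_within_open)
      (use U V T chart(5)[OF U(1)] in \<open>auto simp: h_def\<close>)
  then have "speed A g (f \<circ> \<gamma>) t = sqrt (g (V, \<psi>) (f (\<gamma> t))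
      (frechet_derivative h (at (\<phi> (\<gamma> t))) v) (frechet_derivative h (at (\<phi> (\<gamma> t))) v))"
    unfolding speed_def c Let_def by (simp add: vector_derivative_at)
  also have "\<dots> = sqrt (g (U, \<phi>) (\<gamma> t) v v)"
    unfolding h_def by (subst isometry_metric[OF f U(1) V(1) U(2) V(2)]) (rule refl)
  finally show ?thesis .
qed

text \<open>For the identity, the isometry condition is the smoothness of transition maps together
  with the transformation rule of the metric. So chart independence of the speed is a special case
  of its invariance.\<close>

lemma isometry_id: "isometry A g id"
proof -
  have "smooth_map A id"
    using atlas unfolding smooth_map_def smooth_atlas_def by (auto simp: continuous_on_id id_def o_def)
  then show ?thesis
    using metric unfolding isometry_def riemannian_metric_def by (simp add: inv_id)
qed

lemmas speed_eq = speed_compose[OF isometry_id, unfolded id_o]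

lemma length_compose:
  assumes f: "isometry A g f" and \<gamma>: "C1_off F \<gamma>"
  shows "curve_length A g (f \<circ> \<gamma>) = curve_length A g \<gamma>"
proof -
  have AE: "AE t in lborel. t \<notin> F \<union> {0, 1}"
    using \<gamma> unfolding C1_off_def by (intro AE_not_in finite_imp_null_set_lborel) simp
  have eq: "speed A g (f \<circ> \<gamma>) t = speed A g \<gamma> t" if t: "t \<in> {0<..<1} - F" for t
  proof -
    have cont: "continuous_on {0<..<1} \<gamma>"
      using \<gamma> unfolding C1_off_def path_def by (auto intro: continuous_on_subset)
    obtain U \<phi> v where "(U, \<phi>) \<in> A" "\<gamma> t \<in> U" "((\<phi> \<circ> \<gamma>) has_vector_derivative v) (at t)"
      using C1_off_velocity[OF \<gamma> t] .
    note * = this(1,2) open_greaterThanLessThan _ cont this(3)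
    show ?thesis
      using speed_compose[OF f *] speed_eq[OF *] t by simp
  qed
  show ?thesis
    unfolding curve_length_def
  proof (rule nn_integral_cong_AE)
    show "AE t in lborel. ennreal (speed A g (f \<circ> \<gamma>) t) * indicator {0..1} t
        = ennreal (speed A g \<gamma> t) * indicator {0..1} t"
      using AE
    proof eventually_elim
      case (elim t)
      then show ?case using eq[of t] by (cases "t \<in> {0..1}") auto
    qed
  qed
qed

section \<open>Affine reparametrization, reversal and concatenation\<close>

context
  fixes \<gamma> \<eta> :: "real \<Rightarrow> 'm" and F S :: "real set" and a b :: real
  assumes \<gamma>: "C1_off F \<gamma>" and a: "a \<noteq> 0" and S: "open S" "S \<subseteq> {0<..<1}"
    and \<eta>: "path \<eta>" and sub: "\<And>s. s \<in> S \<Longrightarrow> a * s + b \<in> {0<..<1}"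
    and eq: "\<And>s. s \<in> S \<Longrightarrow> \<eta> s = \<gamma> (a * s + b)"
begin

lemma reparam_finite: "finite ((\<lambda>s. a * s + b) -` F)"
  using \<gamma> a unfolding C1_off_def by (intro finite_vimageI) (auto simp: inj_on_def)

lemma reparam_C1:
  assumes U: "(U, \<phi>) \<in> A"
  shows "(\<phi> \<circ> \<eta>) C1_differentiable_on ((S - (\<lambda>s. a * s + b) -` F) \<inter> \<eta> -` U)" (is "_ C1_differentiable_on ?R")
proof (rule C1_differentiable_on_local)
  fix t assume t: "t \<in> ?R"
  have "((\<phi> \<circ> \<gamma>) \<circ> (\<lambda>s. a * s + b)) C1_differentiable_on ?R"
  proof (rule C1_differentiable_compose)
    have "(\<phi> \<circ> \<gamma>) C1_differentiable_on (({0<..<1} - F) \<inter> \<gamma> -` U)"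
      using \<gamma> U unfolding C1_off_def by blast
    then show "(\<phi> \<circ> \<gamma>) C1_differentiable_on (\<lambda>s. a * s + b) ` ?R"
      by (rule C1_differentiable_on_subset) (use sub eq in auto)
    have "?R \<inter> (\<lambda>s. a * s + b) -` {x} \<subseteq> {(x - b) / a}" for x
      using a by (auto simp: field_simps)
    then show "finite (?R \<inter> (\<lambda>s. a * s + b) -` {x})" for x
      by (rule finite_subset) simp
  qed auto
  then have "((\<phi> \<circ> \<gamma>) \<circ> (\<lambda>s. a * s + b)) C1_differentiable_on (?R \<inter> S)"
    by (rule C1_differentiable_on_subset) auto
  moreover have "\<forall>s\<in>S. ((\<phi> \<circ> \<gamma>) \<circ> (\<lambda>s. a * s + b)) s = (\<phi> \<circ> \<eta>) s"
    using eq by simp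
  ultimately show "\<exists>T h. open T \<and> t \<in> T \<and> h C1_differentiable_on (?R \<inter> T) \<and> (\<forall>s\<in>T. h s = (\<phi> \<circ> \<eta>) s)"
    using S t by (intro exI[of _ S] exI[of _ "(\<phi> \<circ> \<gamma>) \<circ> (\<lambda>s. a * s + b)"]) auto
qed

lemma reparam_speed:
  assumes s: "s \<in> S" "a * s + b \<notin> F"
  shows "speed A g \<eta> s = \<bar>a\<bar> * speed A g \<gamma> (a * s + b)"
proof -
  have t: "a * s + b \<in> {0<..<1} - F" using sub s by simp
  obtain U \<phi> v where U: "(U, \<phi>) \<in> A" "\<gamma> (a * s + b) \<in> U"
    and v: "((\<phi> \<circ> \<gamma>) has_vector_derivative v) (at (a * s + b))"
    using C1_off_velocity[OF \<gamma> t] .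
  have cont: "continuous_on {0<..<1} \<gamma>" "continuous_on S \<eta>"
    using \<gamma> \<eta> S(2) unfolding C1_off_def path_def
    by (auto intro!: continuous_on_subset[where s = "{0..1}"])
  have sp: "speed A g \<gamma> (a * s + b) = sqrt (g (U, \<phi>) (\<gamma> (a * s + b)) v v)"
    using t by (intro speed_eq[OF U _ _ cont(1) v]) auto
  have "((\<lambda>s. a * s + b) has_vector_derivative a) (at s)"
    by (auto intro!: derivative_eq_intros)
  from vector_diff_chain_at[OF this v]
  have "((\<phi> \<circ> \<eta>) has_vector_derivative a *\<^sub>R v) (at s)"
    by (rule has_vector_derivative_transform_within_open[OF _ S(1) s(1)]) (simp add: eq)
  then have "speed A g \<eta> s = sqrt (g (U, \<phi>) (\<eta> s) (a *\<^sub>R v) (a *\<^sub>R v))"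
    using U eq[OF s(1)] by (intro speed_eq[OF U(1) _ S(1) s(1) cont(2)]) simp_all
  also have "\<dots> = sqrt (a\<^sup>2 * g (U, \<phi>) (\<gamma> (a * s + b)) v v)"
  proof -
    have "\<forall>p\<in>U. bilinear (g (U, \<phi>) p)"
      using metric U(1) unfolding riemannian_metric_def by blast
    then have "bilinear (g (U, \<phi>) (\<gamma> (a * s + b)))" using U(2) by blast
    then show ?thesis
      using eq[OF s(1)] by (simp add: bilinear_lmul bilinear_rmul power2_eq_square)
  qed
  finally show ?thesis
    unfolding sp by (simp add: real_sqrt_mult)
qed

text \<open>This is the substitution \<open>x = a * s + b\<close>: the factor
  \<open>\<bar>1 / a\<bar>\<close> cancels the one in \<open>reparam_speed\<close>. It is an
  inequality because the substitution rule for lower integrals is one; for upper bounds on an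
  infimum of lengths this direction is the right one.\<close>

lemma reparam_length:
  "(\<integral>\<^sup>+s. ennreal (speed A g \<eta> s) * indicator S s \<partial>lborel) \<le> curve_length A g \<gamma>"
proof -
  have "(\<integral>\<^sup>+s. ennreal (speed A g \<eta> s) * indicator S s \<partial>lborel)
      \<le> (\<integral>\<^sup>+x. ennreal \<bar>1 / a\<bar> *
          (ennreal (speed A g \<eta> (- b / a + 1 / a * x)) * indicator S (- b / a + 1 / a * x)) \<partial>lborel)"
    using a by (intro nn_integral_real_affine_le) simp
  also have "\<dots> \<le> curve_length A g \<gamma>"
    unfolding curve_length_def
  proof (rule nn_integral_mono_AE)
    have "AE x in lborel. x \<notin> F"
      using \<gamma> unfolding C1_off_def by (intro AE_not_in finite_imp_null_set_lborel) simp
    then show "AE x in lborel. ennreal \<bar>1 / a\<bar> *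
          (ennreal (speed A g \<eta> (- b / a + 1 / a * x)) * indicator S (- b / a + 1 / a * x))
        \<le> ennreal (speed A g \<gamma> x) * indicator {0..1} x"
    proof eventually_elim
      case (elim x)
      define s where "s = - b / a + 1 / a * x"
      have x: "a * s + b = x"
        unfolding s_def using a by (simp add: field_simps)
      show ?case
      proof (cases "s \<in> S")
        case True
        then have "speed A g \<eta> s = \<bar>a\<bar> * speed A g \<gamma> x"
          using reparam_speed[of s] elim unfolding x by simp
        moreover have "x \<in> {0..1}" using sub[OF True] unfolding x by simp
        ultimately show ?thesis
          using a True unfolding s_def[symmetric] by (simp add: ennreal_mult'[symmetric])
      next
        case False
        then show ?thesis unfolding s_def[symmetric] by simp
      qed
    qed
  qed
  finally show ?thesis .
qed

end

lemma curve_length_interior: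
  "curve_length A g \<gamma> = (\<integral>\<^sup>+s. ennreal (speed A g \<gamma> s) * indicator {0<..<1} s \<partial>lborel)"
  unfolding curve_length_def
proof (rule nn_integral_cong_AE)
  have "AE t in lborel. t \<notin> {0, 1::real}"
    by (intro AE_not_in finite_imp_null_set_lborel) simp
  then show "AE t in lborel. ennreal (speed A g \<gamma> t) * indicator {0..1} t
      = ennreal (speed A g \<gamma> t) * indicator {0<..<1} t"
    by eventually_elim (auto split: split_indicator)
qed

lemma C1_off_reverse:
  assumes "C1_off F \<gamma>"
  shows "C1_off ((\<lambda>s. -1 * s + 1) -` F) (reversepath \<gamma>)"
    and "curve_length A g (reversepath \<gamma>) \<le> curve_length A g \<gamma>"
proof -
  have p: "path (reversepath \<gamma>)"
    using assms unfolding C1_off_def by simp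
  note r = assms _ open_greaterThanLessThan order.refl p
  have s: "-1 * s + 1 \<in> {0<..<1}" "reversepath \<gamma> s = \<gamma> (-1 * s + 1)"
    if "s \<in> {0<..<1}" for s :: real
    using that unfolding reversepath_def by simp_all
  show "C1_off ((\<lambda>s. -1 * s + 1) -` F) (reversepath \<gamma>)"
    using p reparam_finite[OF r s] reparam_C1[OF r s] unfolding C1_off_def by auto
  show "curve_length A g (reversepath \<gamma>) \<le> curve_length A g \<gamma>"
    unfolding curve_length_interior[of "reversepath \<gamma>"] by (rule reparam_length[OF r s]) simp_all
qed

lemma C1_off_join:
  assumes \<gamma>: "C1_off F \<gamma>" "C1_off F' \<gamma>'" and "pathfinish \<gamma> = pathstart \<gamma>'"
  obtains G where "C1_off G (\<gamma> +++ \<gamma>')"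
    and "curve_length A g (\<gamma> +++ \<gamma>') \<le> curve_length A g \<gamma> + curve_length A g \<gamma>'"
proof -
  define \<eta> where "\<eta> = \<gamma> +++ \<gamma>'"
  define L R :: "real set" where "L = {0<..<1/2}" and "R = {1/2<..<1}"
  \<comment> \<open>The pullbacks of both exceptional sets, and the possible corner at the junction
    \<open>1/2\<close>. The summand 0 gives the first half the form
    \<open>a * s + b\<close>.\<close>
  define G where "G = (\<lambda>s. 2 * s + 0) -` F \<union> (\<lambda>s. 2 * s + (-1)) -` F' \<union> {1/2}"
  have p: "path \<eta>"
    using assms unfolding C1_off_def \<eta>_def by (simp add: path_join_imp)
  have L: "2 * s + 0 \<in> {0<..<1}" "\<eta> s = \<gamma> (2 * s + 0)" if "s \<in> L" for s
    using that unfolding L_def \<eta>_def joinpaths_def by auto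
  have R: "2 * s + (-1) \<in> {0<..<1}" "\<eta> s = \<gamma>' (2 * s + (-1))" if "s \<in> R" for s
    using that unfolding R_def \<eta>_def joinpaths_def by auto
  have LR: "open L" "L \<subseteq> {0<..<1}" "open R" "R \<subseteq> {0<..<1}"
    unfolding L_def R_def by auto
  note l = \<gamma>(1) _ LR(1,2) p L
  note r = \<gamma>(2) _ LR(3,4) p R
  have "(\<phi> \<circ> \<eta>) C1_differentiable_on (({0<..<1} - G) \<inter> \<eta> -` U)" if U: "(U, \<phi>) \<in> A" for U \<phi>
  proof (rule C1_differentiable_on_local)
    fix t assume t: "t \<in> ({0<..<1} - G) \<inter> \<eta> -` U"
    have "(\<phi> \<circ> \<eta>) C1_differentiable_on (({0<..<1} - G) \<inter> \<eta> -` U \<inter> L)"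
      using reparam_C1[OF l U] by (rule C1_differentiable_on_subset) (auto simp: G_def)
    moreover have "(\<phi> \<circ> \<eta>) C1_differentiable_on (({0<..<1} - G) \<inter> \<eta> -` U \<inter> R)"
      using reparam_C1[OF r U] by (rule C1_differentiable_on_subset) (auto simp: G_def)
    moreover have "t \<in> L \<or> t \<in> R"
      using t unfolding L_def R_def G_def by auto
    ultimately show "\<exists>T h. open T \<and> t \<in> T \<and>
        h C1_differentiable_on (({0<..<1} - G) \<inter> \<eta> -` U \<inter> T) \<and> (\<forall>s\<in>T. h s = (\<phi> \<circ> \<eta>) s)"
      using LR by blast
  qed
  moreover have "finite G"
    unfolding G_def using reparam_finite[OF l] reparam_finite[OF r] by simp
  ultimately have "C1_off G \<eta>"
    using p unfolding C1_off_def by blast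
  moreover have "curve_length A g \<eta> \<le> curve_length A g \<gamma> + curve_length A g \<gamma>'"
  proof -
    define f where "f = (\<lambda>s. ennreal (speed A g \<eta> s))"
    have half: "AE s in lborel. s \<notin> {1/2 :: real}"
      by (intro AE_not_in finite_imp_null_set_lborel) simp
    have "curve_length A g \<eta> \<le> (\<integral>\<^sup>+s. (f s * indicator {0<..<1} s) * indicator L s \<partial>lborel)
        + (\<integral>\<^sup>+s. (f s * indicator {0<..<1} s) * indicator (- L) s \<partial>lborel)"
      unfolding curve_length_interior f_def by (rule nn_integral_split_le) (simp add: L_def)
    also have "\<dots> = (\<integral>\<^sup>+s. f s * indicator L s \<partial>lborel) + (\<integral>\<^sup>+s. f s * indicator R s \<partial>lborel)"
    proof (intro arg_cong2[where f = plus] nn_integral_cong_AE)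
      show "AE s in lborel. (f s * indicator {0<..<1} s) * indicator L s = f s * indicator L s"
        by (auto simp: L_def split: split_indicator)
      show "AE s in lborel. (f s * indicator {0<..<1} s) * indicator (- L) s = f s * indicator R s"
        using half by eventually_elim (auto simp: L_def R_def split: split_indicator)
    qed
    also have "\<dots> \<le> curve_length A g \<gamma> + curve_length A g \<gamma>'"
      unfolding f_def by (intro add_mono reparam_length[OF l] reparam_length[OF r]) simp_all
    finally show ?thesis .
  qed
  ultimately show thesis
    using that unfolding \<eta>_def by blast
qed

section \<open>The distance with values in \<open>ennreal\<close>: metric properties and upper
  semicontinuity\<close>

definition edist :: "'m \<Rightarrow> 'm \<Rightarrow> ennreal" where
  "edist x y = (INF \<gamma>\<in>{\<gamma>. piecewise_C1_curve A \<gamma> \<and> pathstart \<gamma> = x \<and> pathfinish \<gamma> = y}.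
       curve_length A g \<gamma>)"

text \<open>\<open>enn2real\<close> maps \<open>top\<close> to 0 and so is not monotone; all
  inequalities are therefore proved for \<open>edist\<close> and transferred only at the
  end.\<close>

lemma geodesic_dist_edist: "geodesic_dist A g x y = enn2real (edist x y)"
  unfolding geodesic_dist_def edist_def ..

lemma edist_le:
  "C1_off F \<gamma> \<Longrightarrow> pathstart \<gamma> = x \<Longrightarrow> pathfinish \<gamma> = y \<Longrightarrow> edist x y \<le> curve_length A g \<gamma>"
  unfolding edist_def piecewise_C1_curve_C1_off by (rule INF_lower) auto

lemma edist_greatest:
  assumes "\<And>F \<gamma>. C1_off F \<gamma> \<Longrightarrow> pathstart \<gamma> = x \<Longrightarrow> pathfinish \<gamma> = y \<Longrightarrow> c \<le> curve_length A g \<gamma>"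
  shows "c \<le> edist x y"
  unfolding edist_def piecewise_C1_curve_C1_off using assms by (auto intro!: INF_greatest)

lemma edist_sym: "edist x y = edist y x"
proof -
  have "edist y x \<le> edist x y" for x y
  proof (rule edist_greatest)
    fix F \<gamma> assume "C1_off F \<gamma>" "pathstart \<gamma> = x" "pathfinish \<gamma> = y"
    then show "edist y x \<le> curve_length A g \<gamma>"
      using edist_le[OF C1_off_reverse(1), of F \<gamma> y x] C1_off_reverse(2)[of F \<gamma>] by auto
  qed
  then show ?thesis by (simp add: antisym)
qed

lemma edist_triangle: "edist x z \<le> edist x y + edist y z"
proof (rule ennreal_le_epsilon)
  fix e :: real assume fin: "edist x y + edist y z < top" and e: "0 < e"
  have approx: "\<exists>F \<gamma>. C1_off F \<gamma> \<and> pathstart \<gamma> = p \<and> pathfinish \<gamma> = q \<and>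
      curve_length A g \<gamma> \<le> edist p q + ennreal (e / 2)" if "edist p q < top" for p q
  proof -
    have "\<exists>\<gamma>\<in>{\<gamma>. piecewise_C1_curve A \<gamma> \<and> pathstart \<gamma> = p \<and> pathfinish \<gamma> = q}.
        curve_length A g \<gamma> < edist p q + ennreal (e / 2)"
      using e that by (intro INF_approx_ennreal[OF _ edist_def]) auto
    then show ?thesis
      unfolding piecewise_C1_curve_C1_off by (auto intro: less_imp_le)
  qed
  obtain F \<gamma> where \<gamma>: "C1_off F \<gamma>" "pathstart \<gamma> = x" "pathfinish \<gamma> = y"
    "curve_length A g \<gamma> \<le> edist x y + ennreal (e / 2)"
    using approx[of x y] fin by (auto simp: ennreal_add_less_top)
  obtain F' \<gamma>' where \<gamma>': "C1_off F' \<gamma>'" "pathstart \<gamma>' = y" "pathfinish \<gamma>' = z"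
    "curve_length A g \<gamma>' \<le> edist y z + ennreal (e / 2)"
    using approx[of y z] fin by (auto simp: ennreal_add_less_top)
  obtain G where G: "C1_off G (\<gamma> +++ \<gamma>')"
    "curve_length A g (\<gamma> +++ \<gamma>') \<le> curve_length A g \<gamma> + curve_length A g \<gamma>'"
    using C1_off_join[OF \<gamma>(1) \<gamma>'(1)] \<gamma> \<gamma>' by metis
  have "edist x z \<le> curve_length A g (\<gamma> +++ \<gamma>')"
    using \<gamma>(2) \<gamma>'(3) by (intro edist_le[OF G(1)]) auto
  also have "\<dots> \<le> (edist x y + ennreal (e / 2)) + (edist y z + ennreal (e / 2))"
    using G(2) add_mono[OF \<gamma>(4) \<gamma>'(4)] by (rule order_trans)
  also have "\<dots> = edist x y + edist y z + (ennreal (e / 2) + ennreal (e / 2))"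
    by (simp only: ac_simps)
  also have "ennreal (e / 2) + ennreal (e / 2) = ennreal e"
    using e by (subst ennreal_plus[symmetric]) auto
  finally show "edist x z \<le> edist x y + edist y z + ennreal e" .
qed

lemma edist_isometry:
  assumes f: "isometry A g f"
  shows "edist (f x) (f y) = edist x y"
proof (rule antisym)
  have sm: "smooth_map A f" "smooth_map A (inv f)" and "bij f"
    using f unfolding isometry_def by auto
  show "edist (f x) (f y) \<le> edist x y"
  proof (rule edist_greatest)
    fix F \<gamma> assume \<gamma>: "C1_off F \<gamma>" "pathstart \<gamma> = x" "pathfinish \<gamma> = y"
    then show "edist (f x) (f y) \<le> curve_length A g \<gamma>"
      using edist_le[OF C1_off_compose[OF \<gamma>(1) sm(1)]] length_compose[OF f \<gamma>(1)]
      by (simp add: pathstart_compose pathfinish_compose)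
  qed
  show "edist x y \<le> edist (f x) (f y)"
  proof (rule edist_greatest)
    fix F \<gamma> assume \<gamma>: "C1_off F \<gamma>" "pathstart \<gamma> = f x" "pathfinish \<gamma> = f y"
    \<comment> \<open>The metric condition is available for \<open>f\<close>, so length invariance
      is applied to \<open>f\<close> and the pulled-back curve; \<open>inv f\<close> contributes
      smoothness.\<close>
    have "f \<circ> (inv f \<circ> \<gamma>) = \<gamma>"
      using \<open>bij f\<close> by (auto simp: bij_is_surj surj_f_inv_f)
    then have "curve_length A g (inv f \<circ> \<gamma>) = curve_length A g \<gamma>"
      using length_compose[OF f C1_off_compose[OF \<gamma>(1) sm(2)]] by simp
    moreover have "edist x y \<le> curve_length A g (inv f \<circ> \<gamma>)"
      using \<gamma> \<open>bij f\<close> by (intro edist_le[OF C1_off_compose[OF \<gamma>(1) sm(2)]])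
        (auto simp: pathstart_compose pathfinish_compose bij_is_inj inv_f_f)
    ultimately show "edist x y \<le> curve_length A g \<gamma>" by simp
  qed
qed

lemma geodesic_dist_nonneg: "geodesic_dist A g x y \<ge> 0"
  by (simp add: geodesic_dist_edist)

lemma geodesic_dist_sym: "geodesic_dist A g x y = geodesic_dist A g y x"
  by (simp add: geodesic_dist_edist edist_sym)

lemma geodesic_dist_isometry:
  "isometry A g f \<Longrightarrow> geodesic_dist A g (f x) (f y) = geodesic_dist A g x y"
  by (simp add: geodesic_dist_edist edist_isometry)

text \<open>The competitor is the curve whose coordinates run along the segment from
  \<open>\<phi> x\<close> to \<open>\<phi> y\<close>. Convexity of the ball keeps it in the chart,
  its coordinate velocity is the constant \<open>w\<close>, and its speed is at most
  \<open>C * norm w\<close>.\<close>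

lemma edist_chart_bound:
  assumes U: "(U, \<phi>) \<in> A" "x \<in> U" "y \<in> U"
    and ball: "ball (\<phi> x) d \<subseteq> \<phi> ` U" "\<phi> y \<in> ball (\<phi> x) d"
    and bound: "\<And>z w. z \<in> ball (\<phi> x) d \<Longrightarrow> g (U, \<phi>) (inv_into U \<phi> z) w w \<le> C\<^sup>2 * (norm w)\<^sup>2"
    and C: "C \<ge> 0"
  shows "edist x y \<le> ennreal (C * dist (\<phi> x) (\<phi> y))"
proof -
  define w where "w = \<phi> y - \<phi> x"
  define c where "c = (\<lambda>t. \<phi> x + t *\<^sub>R w)"
  define \<gamma> where "\<gamma> = inv_into U \<phi> \<circ> c"
  have c: "c t \<in> ball (\<phi> x) d" if "t \<in> {0..1}" for t
  proof -
    have "c t = (1 - t) *\<^sub>R \<phi> x + t *\<^sub>R \<phi> y"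
      unfolding c_def w_def by (simp add: algebra_simps)
    moreover have "\<phi> x \<in> ball (\<phi> x) d"
      using ball(2) by (auto simp: dist_norm intro: le_less_trans[OF norm_ge_zero])
    ultimately show ?thesis
      using that convexD_alt[OF convex_ball, of "\<phi> x" "\<phi> x" d "\<phi> y" t] ball(2) by simp
  qed
  have c_deriv: "(c has_vector_derivative w) (at t)" for t
    unfolding c_def by (auto intro!: derivative_eq_intros)
  have c_C1: "c C1_differentiable_on T" for T
    unfolding C1_differentiable_on_def using c_deriv by (intro exI[of _ "\<lambda>_. w"]) simp
  have "continuous_on {0..1} \<gamma>"
    unfolding \<gamma>_def
  proof (rule continuous_on_compose)
    show "continuous_on {0..1} c" unfolding c_def by (intro continuous_intros)
    show "continuous_on (c ` {0..1}) (inv_into U \<phi>)"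
      using chart(4)[OF U(1)] by (rule continuous_on_subset) (use c ball(1) in blast)
  qed
  then have path: "path \<gamma>" unfolding path_def .
  have \<gamma>U: "\<gamma> t \<in> U" "\<phi> (\<gamma> t) = c t" if "t \<in> {0..1}" for t
    using subsetD[OF ball(1) c[OF that]] unfolding \<gamma>_def
    by (simp_all add: inv_into_into f_inv_into_f)
  have "(\<psi> \<circ> \<gamma>) C1_differentiable_on (({0<..<1} - {}) \<inter> \<gamma> -` V)" if V: "(V, \<psi>) \<in> A" for V \<psi>
  proof -
    have "smooth_on (\<phi> ` (U \<inter> V)) (\<psi> \<circ> inv_into U \<phi>)"
      using atlas U(1) V unfolding smooth_atlas_def by blast
    moreover have "c ` (({0<..<1} - {}) \<inter> \<gamma> -` V) \<subseteq> \<phi> ` (U \<inter> V)"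
    proof
      fix z assume "z \<in> c ` (({0<..<1} - {}) \<inter> \<gamma> -` V)"
      then obtain t where "z = c t" "t \<in> {0..1}" "\<gamma> t \<in> V" by auto
      then show "z \<in> \<phi> ` (U \<inter> V)" using \<gamma>U[of t] by (intro image_eqI[of _ _ "\<gamma> t"]) auto
    qed
    ultimately have "((\<psi> \<circ> inv_into U \<phi>) \<circ> c) C1_differentiable_on (({0<..<1} - {}) \<inter> \<gamma> -` V)"
      by (rule smooth_on_compose_C1[OF _ c_C1])
    then show ?thesis unfolding \<gamma>_def by (simp add: o_assoc)
  qed
  then have "C1_off {} \<gamma>"
    using path unfolding C1_off_def by auto
  moreover have "pathstart \<gamma> = x" "pathfinish \<gamma> = y"
    unfolding pathstart_def pathfinish_def \<gamma>_def c_def w_def using chart(5)[OF U(1)] U by simp_all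
  ultimately have "edist x y \<le> curve_length A g \<gamma>"
    by (rule edist_le)
  also have "\<dots> \<le> (\<integral>\<^sup>+t. ennreal (C * norm w) * indicator {0..1 :: real} t \<partial>lborel)"
    unfolding curve_length_interior
  proof (rule nn_integral_mono)
    fix t :: real
    show "ennreal (speed A g \<gamma> t) * indicator {0<..<1} t \<le> ennreal (C * norm w) * indicator {0..1} t"
    proof (cases "t \<in> {0<..<1}")
      case True
      have "((\<phi> \<circ> \<gamma>) has_vector_derivative w) (at t)"
        by (rule has_vector_derivative_transform_within_open[OF c_deriv open_greaterThanLessThan True])
          (use \<gamma>U in auto)
      moreover have "continuous_on {0<..<1} \<gamma>"
        using path unfolding path_def by (rule continuous_on_subset) auto
      ultimately have "speed A g \<gamma> t = sqrt (g (U, \<phi>) (\<gamma> t) w w)"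
        using True \<gamma>U[of t] by (intro speed_eq[OF U(1) _ open_greaterThanLessThan True]) auto
      also have "\<dots> \<le> sqrt ((C * norm w)\<^sup>2)"
        using bound[OF c[of t], of w] True unfolding \<gamma>_def by (simp add: power_mult_distrib)
      also have "\<dots> = C * norm w"
        using C by simp
      finally show ?thesis
        using True by (simp add: ennreal_leI)
    qed simp
  qed
  also have "\<dots> = ennreal (C * dist (\<phi> x) (\<phi> y))"
    by (subst nn_integral_cmult_indicator) (auto simp: w_def dist_norm norm_minus_commute)
  finally show ?thesis .
qed

text \<open>Continuity of the metric coefficients gives one constant \<open>C\<close> on a
  coordinate ball; on the part of radius at most \<open>e / C\<close> the chart bound is at most
  \<open>e\<close>.\<close>

lemma edist_small_near:
  assumes "e > 0"
  obtains N where "open N" "x \<in> N" "\<And>y. y \<in> N \<Longrightarrow> edist x y \<le> ennreal e"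
proof -
  obtain U \<phi> where U: "(U, \<phi>) \<in> A" "x \<in> U" using chart_at .
  define H where "H = (\<lambda>z. \<Sum>(i, j)\<in>Basis \<times> Basis. \<bar>g (U, \<phi>) (inv_into U \<phi> z) i j\<bar>)"
  have "smooth_on (\<phi> ` U) (\<lambda>z. g (U, \<phi>) (inv_into U \<phi> z) v w)" for v w
    using metric U(1) unfolding riemannian_metric_def by blast
  from smooth_on_D(1)[OF this] have "continuous_on (\<phi> ` U) H"
    unfolding H_def case_prod_beta by (intro continuous_intros)
  then have "open (H -` {..<H (\<phi> x) + 1} \<inter> \<phi> ` U)"
    using chart(2)[OF U(1)] by (simp add: continuous_on_open_vimage)
  moreover have "\<phi> x \<in> H -` {..<H (\<phi> x) + 1} \<inter> \<phi> ` U"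
    using U(2) by simp
  ultimately obtain d where d: "d > 0" "ball (\<phi> x) d \<subseteq> H -` {..<H (\<phi> x) + 1} \<inter> \<phi> ` U"
    by (meson openE)
  \<comment> \<open>The 1 leaves room for continuity of \<open>H\<close> on a neighbourhood and
    makes \<open>C\<close> positive, so that \<open>e / C\<close> is a valid radius.\<close>
  define C where "C = sqrt (H (\<phi> x) + 1)"
  have "H (\<phi> x) \<ge> 0"
    unfolding H_def by (auto intro!: sum_nonneg)
  then have C: "C > 0" "C\<^sup>2 = H (\<phi> x) + 1"
    unfolding C_def by simp_all
  have bound: "g (U, \<phi>) (inv_into U \<phi> z) w w \<le> C\<^sup>2 * (norm w)\<^sup>2" if z: "z \<in> ball (\<phi> x) d" for z w
  proof -
    have "inv_into U \<phi> z \<in> U" "H z \<le> C\<^sup>2"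
      using subsetD[OF d(2) z] C(2) by (simp_all add: inv_into_into)
    moreover have "\<forall>p\<in>U. bilinear (g (U, \<phi>) p)"
      using metric U(1) unfolding riemannian_metric_def by blast
    ultimately have "\<bar>g (U, \<phi>) (inv_into U \<phi> z) w w\<bar> \<le> H z * (norm w)\<^sup>2"
      unfolding H_def by (intro bilinear_norm_bound) blast
    also have "\<dots> \<le> C\<^sup>2 * (norm w)\<^sup>2"
      using \<open>H z \<le> C\<^sup>2\<close> by (rule mult_right_mono) simp
    finally show ?thesis by linarith
  qed
  define N where "N = \<phi> -` ball (\<phi> x) (min d (e / C)) \<inter> U"
  show thesis
  proof
    show "open N"
      unfolding N_def using chart(1,3)[OF U(1)] by (simp add: continuous_on_open_vimage)
    show "x \<in> N" unfolding N_def using d(1) assms C U by simp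
    fix y assume y: "y \<in> N"
    have "edist x y \<le> ennreal (C * dist (\<phi> x) (\<phi> y))"
      using y d(2) C(1) unfolding N_def by (intro edist_chart_bound[OF U _ _ _ bound]) auto
    also have "\<dots> \<le> ennreal e"
      using y C(1) unfolding N_def by (intro ennreal_leI) (simp add: pos_less_divide_eq mult.commute)
    finally show "edist x y \<le> ennreal e" .
  qed
qed

text \<open>Moving both endpoints slightly costs, by the triangle inequality, at most the two small
  distances that \<open>edist_small_near\<close> controls.\<close>

lemma open_edist_less: "open {p. edist (fst p) (snd p) < c}"
proof (subst open_subopen, rule ballI)
  fix p assume "p \<in> {p. edist (fst p) (snd p) < c}"
  then obtain x y where p: "p = (x, y)" and less: "edist x y < c" by (cases p) auto
  \<comment> \<open>\<open>c\<close> may be \<open>top\<close>; an intermediate value below it makes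
    the gap a real number.\<close>
  obtain c' where c': "edist x y < c'" "c' < c" using dense[OF less] by blast
  obtain D where D: "edist x y = ennreal D" "D \<ge> 0"
    using c'(1) by (cases "edist x y") auto
  obtain E where E: "c' = ennreal E" "E \<ge> 0"
    using c'(2) by (cases c') auto
  \<comment> \<open>Half of the gap for each endpoint.\<close>
  define e where "e = (E - D) / 2"
  have "D < E" using c'(1) D E by (simp add: ennreal_less_iff)
  then have e: "e > 0" and "D + e + e = E"
    unfolding e_def by simp_all
  obtain N where N: "open N" "x \<in> N" "\<And>z. z \<in> N \<Longrightarrow> edist x z \<le> ennreal e"
    using edist_small_near[OF e] by blast
  obtain N' where N': "open N'" "y \<in> N'" "\<And>z. z \<in> N' \<Longrightarrow> edist y z \<le> ennreal e"
    using edist_small_near[OF e] by blast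
  have "N \<times> N' \<subseteq> {p. edist (fst p) (snd p) < c}"
  proof clarify
    fix x' y' assume "x' \<in> N" "y' \<in> N'"
    have "edist x' y' \<le> edist x' x + (edist x y + edist y y')"
      using edist_triangle[of x' y' x] add_left_mono[OF edist_triangle[of x y' y]] by (rule order_trans)
    also have "\<dots> \<le> ennreal e + (ennreal D + ennreal e)"
      using N(3)[OF \<open>x' \<in> N\<close>] N'(3)[OF \<open>y' \<in> N'\<close>] edist_sym[of x x'] D(1)
      by (intro add_mono) simp_all
    also have "\<dots> = ennreal (D + e + e)"
      using D(2) e by (simp add: ac_simps flip: ennreal_plus)
    also have "\<dots> < c"
      using \<open>D + e + e = E\<close> c'(2) E(1) by simp
    finally show "edist (fst (x', y')) (snd (x', y')) < c" by simp
  qed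
  then show "\<exists>T. open T \<and> p \<in> T \<and> T \<subseteq> {p. edist (fst p) (snd p) < c}"
    using N N' p by (intro exI[of _ "N \<times> N'"]) (simp add: open_Times)
qed

lemma geodesic_dist_measurable:
  "(\<lambda>(x, y). geodesic_dist A g x y) \<in> borel_measurable (borel \<Otimes>\<^sub>M borel)"
proof -
  have "(\<lambda>p. edist (fst p) (snd p)) \<in> borel_measurable borel"
    using open_edist_less by (intro borel_measurableI_less) simp
  \<comment> \<open>Second countability identifies the Borel sets of the product space with the
    product sigma-algebra.\<close>
  then have "(\<lambda>p. enn2real (edist (fst p) (snd p))) \<in> borel_measurable (borel \<Otimes>\<^sub>M borel)"
    by (simp add: borel_prod)
  then show ?thesis
    by (simp add: geodesic_dist_edist case_prod_beta)
qed

end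

section \<open>Poisson averages\<close>

text \<open>For \<open>t \<ge> 0\<close> this is the expectation of \<open>a\<close> at a Poisson
  variable of mean \<open>t\<close>. As a power series it also makes sense for negative
  \<open>t\<close>, which gives two-sided derivatives at 0 too.\<close>

definition poisson_average :: "(nat \<Rightarrow> real) \<Rightarrow> real \<Rightarrow> real" where
  "poisson_average a t = exp (- t) * (\<Sum>k. a k / fact k * t ^ k)"

lemma poisson_sums_exp: "(\<lambda>k. B / fact k * t ^ k) sums (B * exp t)" for B t :: real
  using sums_mult[OF exp_converges[of t], of B] by (simp add: field_simps)

lemma poisson_summable_exp: "summable (\<lambda>k. B / fact k * t ^ k)" for B t :: real
  using poisson_sums_exp by (rule sums_summable)

lemma poisson_summable_abs:
  fixes a :: "nat \<Rightarrow> real"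
  assumes "\<And>k. \<bar>a k\<bar> \<le> B"
  shows "summable (\<lambda>k. \<bar>a k / fact k * t ^ k\<bar>)"
proof (rule summable_comparison_test')
  show "summable (\<lambda>k. B / fact k * \<bar>t\<bar> ^ k)"
    by (rule poisson_summable_exp)
  show "norm \<bar>a k / fact k * t ^ k\<bar> \<le> B / fact k * \<bar>t\<bar> ^ k" if "k \<ge> 0" for k
    using assms[of k] by (auto simp: abs_mult power_abs intro!: mult_right_mono divide_right_mono)
qed

lemma poisson_summable:
  fixes a :: "nat \<Rightarrow> real"
  assumes "\<And>k. \<bar>a k\<bar> \<le> B"
  shows "summable (\<lambda>k. a k / fact k * t ^ k)"
  using poisson_summable_abs[OF assms] by (rule summable_rabs_cancel)

text \<open>For \<open>t \<ge> 0\<close> the weights \<open>exp (- t) * t ^ k / fact k\<close> are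
  nonnegative and sum to 1.\<close>

lemma poisson_average_bound:
  assumes a: "\<And>k. \<bar>a k\<bar> \<le> B" and "t \<ge> 0"
  shows "\<bar>poisson_average a t\<bar> \<le> B"
proof -
  have "\<bar>\<Sum>k. a k / fact k * t ^ k\<bar> \<le> (\<Sum>k. \<bar>a k / fact k * t ^ k\<bar>)"
    by (rule summable_rabs[OF poisson_summable_abs[OF a]])
  also have "\<dots> \<le> (\<Sum>k. B / fact k * t ^ k)"
    using a \<open>t \<ge> 0\<close>
    by (intro suminf_le poisson_summable_abs[OF a] poisson_summable_exp)
      (auto simp: abs_mult intro!: mult_right_mono divide_right_mono)
  also have "\<dots> = B * exp t"
    using poisson_sums_exp sums_unique by metis
  finally have "\<bar>poisson_average a t\<bar> \<le> exp (- t) * (B * exp t)"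
    unfolding poisson_average_def abs_mult by simp
  then show ?thesis by (simp add: exp_minus field_simps)
qed

lemma poisson_average_diff:
  assumes "\<And>k. \<bar>a k\<bar> \<le> B" and "\<And>k. \<bar>b k\<bar> \<le> C"
  shows "poisson_average (\<lambda>k. a k - b k) t = poisson_average a t - poisson_average b t"
  unfolding poisson_average_def
  using suminf_diff[OF poisson_summable[of a, OF assms(1), of t] poisson_summable[of b, OF assms(2), of t]]
  by (simp add: algebra_simps diff_divide_distrib)

lemma poisson_average_0 [simp]: "poisson_average a 0 = a 0"
  unfolding poisson_average_def using powser_zero[of "\<lambda>k. a k / fact k"] by simp

text \<open>Differentiating the series shifts the sequence, and differentiating
  \<open>exp (- t)\<close> subtracts it. When \<open>a\<close> consists of iterates of an operator,
  shift minus identity is that operator minus 1.\<close>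

lemma poisson_average_DERIV:
  assumes a: "\<And>k. \<bar>a k\<bar> \<le> B"
  shows "(poisson_average a has_field_derivative poisson_average (\<lambda>k. a (Suc k) - a k) t) (at t)"
proof -
  have "diffs (\<lambda>k. a k / fact k) = (\<lambda>k. a (Suc k) / fact k)"
    by (rule ext) (simp add: diffs_def divide_simps del: of_nat_Suc)
  moreover have "((\<lambda>t. \<Sum>k. a k / fact k * t ^ k) has_field_derivative
      (\<Sum>k. diffs (\<lambda>k. a k / fact k) k * t ^ k)) (at t)"
    by (rule termdiffs_strong[where K = "\<bar>t\<bar> + 1"]) (auto intro: poisson_summable[OF a] simp del: times_divide_eq_left)
  ultimately have "(poisson_average a has_field_derivative
      (poisson_average (\<lambda>k. a (Suc k)) t - poisson_average a t)) (at t)"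
    unfolding poisson_average_def[abs_def]
    by (auto intro!: derivative_eq_intros simp: algebra_simps)
  then show ?thesis
    using poisson_average_diff[of "\<lambda>k. a (Suc k)" B a B t] a by simp
qed

lemma poisson_average_lipschitz:
  assumes a: "\<And>k. \<bar>a k\<bar> \<le> B" and "t \<ge> 0" "s \<ge> 0"
  shows "\<bar>poisson_average a s - poisson_average a t\<bar> \<le> 2 * B * \<bar>s - t\<bar>"
proof -
  have d: "\<bar>a (Suc k) - a k\<bar> \<le> 2 * B" for k
    using a[of k] a[of "Suc k"] by linarith
  have "norm (poisson_average a s - poisson_average a t) \<le> 2 * B * norm (s - t)"
  proof (rule field_differentiable_bound[where S = "{0..}"])
    show "(poisson_average a has_field_derivative poisson_average (\<lambda>k. a (Suc k) - a k) r)
        (at r within {0..})" for r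
      by (rule has_field_derivative_at_within[OF poisson_average_DERIV[OF a]])
    show "norm (poisson_average (\<lambda>k. a (Suc k) - a k) r) \<le> 2 * B" if "r \<in> {0..}" for r
      using poisson_average_bound[OF d] that by simp
  qed (use assms in auto)
  then show ?thesis by simp
qed

text \<open>The mean value inequality is applied after subtracting the linear function of slope
  \<open>w\<close>. The derivative is then a difference of Poisson averages of \<open>b\<close>,
  which is bounded by \<open>2 * B\<close> and hence has Lipschitz constant
  \<open>4 * B\<close>.\<close>

lemma poisson_average_taylor:
  assumes a: "\<And>k. \<bar>a k\<bar> \<le> B" and "t \<ge> 0" "s \<ge> 0" "s \<noteq> t"
  shows "\<bar>(poisson_average a s - poisson_average a t) / (s - t)
      - poisson_average (\<lambda>k. a (Suc k) - a k) t\<bar> \<le> 4 * B * \<bar>s - t\<bar>"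
proof -
  define b where "b = (\<lambda>k. a (Suc k) - a k)"
  define w where "w = poisson_average b t"
  have b: "\<bar>b k\<bar> \<le> 2 * B" for k
    using a[of k] a[of "Suc k"] unfolding b_def by linarith
  have B: "B \<ge> 0" using a[of 0] by linarith
  have "norm ((poisson_average a s - w * s) - (poisson_average a t - w * t))
      \<le> 4 * B * \<bar>s - t\<bar> * norm (s - t)"
  proof (rule field_differentiable_bound[where S = "closed_segment s t"
        and f' = "\<lambda>r. poisson_average b r - w"])
    fix r assume r: "r \<in> closed_segment s t"
    show "((\<lambda>r. poisson_average a r - w * r) has_field_derivative poisson_average b r - w)
        (at r within closed_segment s t)"
      unfolding b_def
      by (intro DERIV_diff has_field_derivative_at_within[OF poisson_average_DERIV[OF a]]
          DERIV_cmult_Id)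
    have "r \<ge> 0" "\<bar>r - t\<bar> \<le> \<bar>s - t\<bar>"
      using r assms(2,3) by (auto simp: closed_segment_eq_real_ivl split: if_splits)
    then have "\<bar>poisson_average b r - w\<bar> \<le> 2 * (2 * B) * \<bar>r - t\<bar>"
      unfolding w_def using assms(2) \<open>r \<ge> 0\<close> by (intro poisson_average_lipschitz b)
    also have "\<dots> \<le> 4 * B * \<bar>s - t\<bar>"
      using B \<open>\<bar>r - t\<bar> \<le> \<bar>s - t\<bar>\<close> by (simp add: mult_left_mono)
    finally show "norm (poisson_average b r - w) \<le> 4 * B * \<bar>s - t\<bar>" by simp
  qed auto
  then have "\<bar>(poisson_average a s - poisson_average a t) - w * (s - t)\<bar>
      \<le> 4 * B * \<bar>s - t\<bar> * \<bar>s - t\<bar>"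
    by (simp add: right_diff_distrib)
  moreover have "(poisson_average a s - poisson_average a t) - w * (s - t) =
      ((poisson_average a s - poisson_average a t) / (s - t) - w) * (s - t)"
    using assms(4) by (subst left_diff_distrib) simp
  ultimately have "\<bar>(poisson_average a s - poisson_average a t) / (s - t) - w\<bar> * \<bar>s - t\<bar>
      \<le> 4 * B * \<bar>s - t\<bar> * \<bar>s - t\<bar>"
    by (simp only: abs_mult)
  then show ?thesis
    using assms(4) unfolding w_def b_def by (simp add: mult_le_cancel_right)
qed

section \<open>The essential supremum norm\<close>

lemma Linf_norm_le:
  assumes "f \<in> borel_measurable M" "AE x in M. \<bar>f x\<bar> \<le> c"
  shows "Linf_norm M f \<le> ereal c"
  unfolding Linf_norm_def using assms by (auto intro!: esssup_I)

lemma Linf_I: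
  assumes "f \<in> borel_measurable M" "AE x in M. \<bar>f x\<bar> \<le> c"
  shows "f \<in> Linf M"
  using Linf_norm_le[OF assms] assms(1) less_ereal.simps(4) le_less_trans
  unfolding Linf_def by blast

lemma AE_le_Linf_norm:
  assumes "f \<in> borel_measurable M"
  shows "AE x in M. ereal \<bar>f x\<bar> \<le> Linf_norm M f"
  unfolding Linf_norm_def using assms esssup_AE[of "\<lambda>x. ereal \<bar>f x\<bar>" M] by simp

text \<open>On a null measure the essential supremum of a measurable function is negative infinity.
  Excluding this makes the norm nonnegative, and on \<open>Linf\<close> a real number.\<close>

locale nonnull_measure =
  fixes \<mu> :: "'a measure"
  assumes nonnull: "ae_filter \<mu> \<noteq> bot"
begin

lemma Linf_norm_nonneg: "Linf_norm \<mu> f \<ge> 0"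
proof (cases "f \<in> borel_measurable \<mu>")
  case True
  show ?thesis
  proof (rule ccontr)
    assume "\<not> ?thesis"
    then have "\<not> ereal \<bar>f x\<bar> \<le> Linf_norm \<mu> f" for x
      by (metis abs_ge_zero ereal_less_eq(5) order_trans)
    then have "AE x in \<mu>. False"
      using AE_le_Linf_norm[OF True] by simp
    with nonnull show False by (simp add: trivial_limit_def)
  qed
qed (simp add: Linf_norm_def)

abbreviation norm_Linf :: "('a \<Rightarrow> real) \<Rightarrow> real" where
  "norm_Linf f \<equiv> real_of_ereal (Linf_norm \<mu> f)"

lemma Linf_norm_real: "f \<in> Linf \<mu> \<Longrightarrow> Linf_norm \<mu> f = ereal (norm_Linf f)"
  using Linf_norm_nonneg[of f] unfolding Linf_def by (cases "Linf_norm \<mu> f") auto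

lemma norm_Linf_nonneg: "0 \<le> norm_Linf f"
  by (simp add: Linf_norm_nonneg real_of_ereal_pos)

lemma AE_le_norm_Linf:
  assumes "f \<in> Linf \<mu>"
  shows "AE x in \<mu>. \<bar>f x\<bar> \<le> norm_Linf f"
proof -
  obtain r where r: "Linf_norm \<mu> f = ereal r"
    using Linf_norm_real[OF assms] by blast
  show ?thesis
    using AE_le_Linf_norm[of f \<mu>] assms by (simp add: r Linf_def)
qed

lemma norm_Linf_le:
  assumes "f \<in> borel_measurable \<mu>" "AE x in \<mu>. \<bar>f x\<bar> \<le> c"
  shows "norm_Linf f \<le> c"
proof -
  obtain r where r: "Linf_norm \<mu> f = ereal r"
    using Linf_norm_real[OF Linf_I[OF assms]] by blast
  show ?thesis
    using Linf_norm_le[OF assms] by (simp add: r)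
qed

lemma Linf_lincomb:
  assumes "f \<in> Linf \<mu>" "h \<in> Linf \<mu>"
  shows "(\<lambda>x. a * f x + b * h x) \<in> Linf \<mu>"
    and "norm_Linf (\<lambda>x. a * f x + b * h x) \<le> \<bar>a\<bar> * norm_Linf f + \<bar>b\<bar> * norm_Linf h"
proof -
  have m: "(\<lambda>x. a * f x + b * h x) \<in> borel_measurable \<mu>"
    using assms unfolding Linf_def by auto
  have "AE x in \<mu>. \<bar>a * f x + b * h x\<bar> \<le> \<bar>a\<bar> * norm_Linf f + \<bar>b\<bar> * norm_Linf h"
    using AE_le_norm_Linf[OF assms(1)] AE_le_norm_Linf[OF assms(2)]
  proof eventually_elim
    case (elim x)
    have "\<bar>a * f x + b * h x\<bar> \<le> \<bar>a\<bar> * \<bar>f x\<bar> + \<bar>b\<bar> * \<bar>h x\<bar>"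
      by (metis abs_mult abs_triangle_ineq)
    also have "\<dots> \<le> \<bar>a\<bar> * norm_Linf f + \<bar>b\<bar> * norm_Linf h"
      using elim by (intro add_mono mult_left_mono) auto
    finally show ?case .
  qed
  with m show "(\<lambda>x. a * f x + b * h x) \<in> Linf \<mu>"
    "norm_Linf (\<lambda>x. a * f x + b * h x) \<le> \<bar>a\<bar> * norm_Linf f + \<bar>b\<bar> * norm_Linf h"
    by (rule Linf_I, rule norm_Linf_le)
qed

lemma Linf_diff:
  assumes "f \<in> Linf \<mu>" "h \<in> Linf \<mu>"
  shows "(\<lambda>x. f x - h x) \<in> Linf \<mu>"
    and "norm_Linf (\<lambda>x. f x - h x) \<le> norm_Linf f + norm_Linf h"
  using Linf_lincomb[OF assms, of 1 "-1"] by simp_all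

end

section \<open>The nonlocal diffusion equation\<close>

text \<open>This is all that the geometry contributes to the equation. Sigma-finiteness makes
  integrals over \<open>y\<close> measurable in \<open>x\<close>.\<close>

locale nonlocal_diffusion = sigma_finite_measure \<mu> for \<mu> :: "'a measure" +
  fixes s :: "'a \<Rightarrow> 'a \<Rightarrow> real" and J :: "real \<Rightarrow> real"
  assumes kernel_measurable: "(\<lambda>(x, y). J (s x y)) \<in> borel_measurable (\<mu> \<Otimes>\<^sub>M \<mu>)"
    and kernel_nonneg: "J (s x y) \<ge> 0"
    and kernel_integral: "(LINT y|\<mu>. J (s x y)) = 1"
begin

text \<open>A non-integrable function has Bochner integral 0 by convention, so the value 1 forces
  integrability.\<close>

lemma kernel_integrable: "integrable \<mu> (\<lambda>y. J (s x y))"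
  using kernel_integral[of x] not_integrable_integral_eq by fastforce

sublocale nonnull_measure \<mu>
proof
  show "ae_filter \<mu> \<noteq> bot"
  proof
    assume "ae_filter \<mu> = bot"
    then have "AE y in \<mu>. J (s undefined y) = 0" by (simp only: eventually_bot)
    then have "(LINT y|\<mu>. J (s undefined y)) = 0" by (rule integral_eq_zero_AE)
    then show False using kernel_integral by simp
  qed
qed

section \<open>The averaging operator on \<open>Linf\<close>\<close>

definition averaging :: "('a \<Rightarrow> real) \<Rightarrow> 'a \<Rightarrow> real" where
  "averaging f x = (LINT y|\<mu>. J (s x y) * f y)"

lemma nonlocal_op_averaging: "nonlocal_op \<mu> s J f x = averaging f x - f x"
  unfolding nonlocal_op_def averaging_def ..

lemma kernel_mult_integrable:
  assumes "f \<in> borel_measurable \<mu>" "AE y in \<mu>. \<bar>f y\<bar> \<le> B"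
  shows "integrable \<mu> (\<lambda>y. J (s x y) * f y)"
proof (rule Bochner_Integration.integrable_bound)
  show "integrable \<mu> (\<lambda>y. J (s x y) * B)"
    using kernel_integrable by simp
  show "(\<lambda>y. J (s x y) * f y) \<in> borel_measurable \<mu>"
    using assms(1) borel_measurable_integrable[OF kernel_integrable] by simp
  show "AE y in \<mu>. norm (J (s x y) * f y) \<le> norm (J (s x y) * B)"
    using assms(2)
  proof eventually_elim
    case (elim y)
    then show ?case
      using kernel_nonneg[of x y] by (simp add: abs_mult mult_left_mono)
  qed
qed

text \<open>For each \<open>x\<close> the kernel is a probability density in \<open>y\<close>.
  Integration ignores null sets, so an almost everywhere bound on \<open>f\<close> turns into a
  bound at every point.\<close>

lemma averaging_bound:
  assumes "f \<in> borel_measurable \<mu>" "AE y in \<mu>. \<bar>f y\<bar> \<le> B"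
  shows "\<bar>averaging f x\<bar> \<le> B"
proof -
  have "norm (averaging f x) \<le> (LINT y|\<mu>. norm (J (s x y) * f y))"
    unfolding averaging_def by (rule integral_norm_bound)
  also have "\<dots> \<le> (LINT y|\<mu>. J (s x y) * B)"
  proof (rule integral_mono_AE)
    show "integrable \<mu> (\<lambda>y. norm (J (s x y) * f y))"
      using kernel_mult_integrable[OF assms] by (rule integrable_norm)
    show "integrable \<mu> (\<lambda>y. J (s x y) * B)"
      using kernel_integrable by simp
    show "AE y in \<mu>. norm (J (s x y) * f y) \<le> J (s x y) * B"
      using assms(2) by eventually_elim (simp add: abs_mult kernel_nonneg mult_left_mono)
  qed
  finally show ?thesis using kernel_integral by simp
qed

lemma averaging_measurable:
  assumes [measurable]: "f \<in> borel_measurable \<mu>"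
  shows "averaging f \<in> borel_measurable \<mu>"
proof -
  note kernel_measurable [measurable]
  have "(\<lambda>(x, y). J (s x y) * f y) \<in> borel_measurable (\<mu> \<Otimes>\<^sub>M \<mu>)"
    unfolding case_prod_beta
    using kernel_measurable[unfolded case_prod_beta] by measurable
  then show ?thesis
    unfolding averaging_def by (rule borel_measurable_lebesgue_integral)
qed

lemma averaging_Linf:
  assumes "f \<in> Linf \<mu>"
  shows "averaging f \<in> Linf \<mu>" and "norm_Linf (averaging f) \<le> norm_Linf f"
proof -
  have f: "f \<in> borel_measurable \<mu>" using assms unfolding Linf_def by simp
  have "AE x in \<mu>. \<bar>averaging f x\<bar> \<le> norm_Linf f"
    using averaging_bound[OF f AE_le_norm_Linf[OF assms]] by simp
  then show "averaging f \<in> Linf \<mu>" "norm_Linf (averaging f) \<le> norm_Linf f"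
    using averaging_measurable[OF f] by (auto intro: Linf_I norm_Linf_le)
qed

lemma averaging_diff:
  assumes "f \<in> Linf \<mu>" "h \<in> Linf \<mu>"
  shows "averaging (\<lambda>y. f y - h y) x = averaging f x - averaging h x"
  using assms kernel_mult_integrable[of f "norm_Linf f" x] kernel_mult_integrable[of h "norm_Linf h" x]
    AE_le_norm_Linf unfolding averaging_def Linf_def by (simp add: right_diff_distrib)

lemma averaging_iterates:
  assumes "f \<in> borel_measurable \<mu>" and "\<And>x. \<bar>f x\<bar> \<le> B"
  shows "(averaging ^^ k) f \<in> borel_measurable \<mu>" and "\<bar>(averaging ^^ k) f x\<bar> \<le> B"
proof (induction k arbitrary: x)
  case 0
  { case 1 show ?case using assms by simp }
  { case 2 show ?case using assms by simp }
next
  case (Suc k)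
  { case 1 show ?case using averaging_measurable[OF Suc(1)] by simp }
  { case 2 show ?case using averaging_bound[OF Suc(1)] Suc(2) by simp }
qed

section \<open>Existence: the Poisson series of iterated averages\<close>

definition diffusion :: "('a \<Rightarrow> real) \<Rightarrow> real \<Rightarrow> 'a \<Rightarrow> real" where
  "diffusion f t x = poisson_average (\<lambda>k. (averaging ^^ k) f x) t"

lemma diffusion_pair_measurable:
  assumes "f \<in> borel_measurable \<mu>" and "\<And>x. \<bar>f x\<bar> \<le> B"
  shows "(\<lambda>(x, t). diffusion f t x) \<in> borel_measurable (\<mu> \<Otimes>\<^sub>M borel)"
proof -
  note [measurable] = averaging_iterates(1)[OF assms]
  show ?thesis
    unfolding diffusion_def poisson_average_def by measurable
qed

lemma Linf_norm_tendsto_0: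
  assumes "\<And>r. r \<ge> 0 \<Longrightarrow> r \<noteq> t \<Longrightarrow> q r \<in> borel_measurable \<mu>"
    and "\<And>r x. r \<ge> 0 \<Longrightarrow> r \<noteq> t \<Longrightarrow> \<bar>q r x\<bar> \<le> C * \<bar>r - t\<bar>"
  shows "((\<lambda>r. Linf_norm \<mu> (q r)) \<longlongrightarrow> 0) (at t within {0..})"
proof (rule tendsto_sandwich[where f = "\<lambda>_. 0" and h = "\<lambda>r. ereal (C * \<bar>r - t\<bar>)"])
  show "\<forall>\<^sub>F r in at t within {0..}. Linf_norm \<mu> (q r) \<le> ereal (C * \<bar>r - t\<bar>)"
    using assms by (auto simp: eventually_at_filter intro!: Linf_norm_le eventuallyI)
  have "((\<lambda>r. C * \<bar>r - t\<bar>) \<longlongrightarrow> C * \<bar>t - t\<bar>) (at t within {0..})"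
    by (intro tendsto_intros)
  then show "((\<lambda>r. ereal (C * \<bar>r - t\<bar>)) \<longlongrightarrow> 0) (at t within {0..})"
    by (simp add: zero_ereal_def)
qed (auto simp: Linf_norm_nonneg)

context
  fixes f :: "'a \<Rightarrow> real" and B :: real
  assumes f: "f \<in> borel_measurable \<mu>" and B: "\<And>x. \<bar>f x\<bar> \<le> B"
begin

lemma diffusion_measurable: "diffusion f t \<in> borel_measurable \<mu>"
proof -
  note [measurable] = averaging_iterates(1)[OF f B]
  show ?thesis
    unfolding diffusion_def poisson_average_def by measurable
qed

lemma diffusion_bound: "t \<ge> 0 \<Longrightarrow> \<bar>diffusion f t x\<bar> \<le> B"
  unfolding diffusion_def by (rule poisson_average_bound[OF averaging_iterates(2)[OF f B]])

lemma diffusion_Linf: "t \<ge> 0 \<Longrightarrow> diffusion f t \<in> Linf \<mu>"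
  by (rule Linf_I[OF diffusion_measurable AE_I2[OF diffusion_bound]])

text \<open>Averaging shifts the sequence of iterates, once integral and series are exchanged. The
  exchange is justified by the summable majorant \<open>B / fact k * \<bar>t\<bar> ^ k\<close>, as
  the kernel has mass 1.\<close>

lemma averaging_diffusion:
  "averaging (diffusion f t) x = poisson_average (\<lambda>k. (averaging ^^ Suc k) f x) t"
proof -
  define h where "h = (\<lambda>k y. J (s x y) * ((averaging ^^ k) f y / fact k * t ^ k))"
  have coef: "\<bar>(averaging ^^ k) f y / fact k * t ^ k\<bar> \<le> B / fact k * \<bar>t\<bar> ^ k" for k y
    using averaging_iterates(2)[OF f B, of k y]
    by (auto simp: abs_mult power_abs intro!: mult_right_mono divide_right_mono)
  have meas: "(\<lambda>y. (averaging ^^ k) f y / fact k * t ^ k) \<in> borel_measurable \<mu>" for k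
    using averaging_iterates(1)[OF f B, of k] by simp
  have int: "integrable \<mu> (h k)" for k
    unfolding h_def by (rule kernel_mult_integrable[OF meas]) (use coef in auto)
  have norm_h: "norm (h k y) = J (s x y) * \<bar>(averaging ^^ k) f y / fact k * t ^ k\<bar>" for k y
    unfolding h_def by (simp add: abs_mult kernel_nonneg)
  have "averaging (\<lambda>y. \<Sum>k. (averaging ^^ k) f y / fact k * t ^ k) x = (LINT y|\<mu>. (\<Sum>k. h k y))"
    unfolding h_def
    using suminf_mult[OF poisson_summable[OF averaging_iterates(2)[OF f B]], symmetric]
    by (subst averaging_def) (intro Bochner_Integration.integral_cong refl)
  also have "\<dots> = (\<Sum>k. LINT y|\<mu>. h k y)"
  proof (rule integral_suminf[OF int])
    show "AE y in \<mu>. summable (\<lambda>k. norm (h k y))"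
      unfolding norm_h
      by (intro AE_I2 summable_mult poisson_summable_abs[OF averaging_iterates(2)[OF f B]])
    show "summable (\<lambda>k. LINT y|\<mu>. norm (h k y))"
    proof (rule summable_comparison_test'[OF poisson_summable_exp[of B "\<bar>t\<bar>"]])
      fix k :: nat
      have "(LINT y|\<mu>. norm (h k y)) = averaging (\<lambda>y. \<bar>(averaging ^^ k) f y / fact k * t ^ k\<bar>) x"
        unfolding norm_h averaging_def ..
      moreover have "\<bar>averaging (\<lambda>y. \<bar>(averaging ^^ k) f y / fact k * t ^ k\<bar>) x\<bar>
          \<le> B / fact k * \<bar>t\<bar> ^ k"
        using meas by (intro averaging_bound borel_measurable_abs) (use coef in auto)
      ultimately show "norm (LINT y|\<mu>. norm (h k y)) \<le> B / fact k * \<bar>t\<bar> ^ k"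
        by simp
    qed
  qed
  also have "\<dots> = (\<Sum>k. (averaging ^^ Suc k) f x / fact k * t ^ k)"
  proof (rule suminf_cong)
    fix k
    have "h k y = (t ^ k / fact k) * (J (s x y) * (averaging ^^ k) f y)" for y
      unfolding h_def by simp
    then have "(LINT y|\<mu>. h k y) = (t ^ k / fact k) * averaging ((averaging ^^ k) f) x"
      unfolding averaging_def by (simp only: integral_mult_right_zero)
    then show "(LINT y|\<mu>. h k y) = (averaging ^^ Suc k) f x / fact k * t ^ k"
      by simp
  qed
  finally have "averaging (\<lambda>y. \<Sum>k. (averaging ^^ k) f y / fact k * t ^ k) x = \<dots>" .
  moreover have "averaging (diffusion f t) x =
      exp (- t) * averaging (\<lambda>y. \<Sum>k. (averaging ^^ k) f y / fact k * t ^ k) x"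
    unfolding averaging_def[of _ x] diffusion_def poisson_average_def
    by (simp only: mult.left_commute[of "J _"] integral_mult_right_zero)
  ultimately show ?thesis
    unfolding poisson_average_def by simp
qed

text \<open>The right-hand side is the time derivative found in
  \<open>poisson_average_DERIV\<close>, so the equation holds at every point;
  \<open>poisson_average_taylor\<close> upgrades this to the norm.\<close>

lemma nonlocal_op_diffusion:
  "nonlocal_op \<mu> s J (diffusion f t) x
    = poisson_average (\<lambda>k. (averaging ^^ Suc k) f x - (averaging ^^ k) f x) t"
  unfolding nonlocal_op_averaging averaging_diffusion diffusion_def
  by (rule poisson_average_diff[symmetric]) (rule averaging_iterates(2)[OF f B])+

lemma diffusion_solves: "cauchy_solution \<mu> s J f (diffusion f)"
proof -
  have "((\<lambda>r. Linf_norm \<mu> (\<lambda>x. diffusion f r x - diffusion f t x)) \<longlongrightarrow> 0) (at t within {0..})"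
    if "t \<ge> 0" for t
  proof (rule Linf_norm_tendsto_0)
    show "\<bar>diffusion f r x - diffusion f t x\<bar> \<le> 2 * B * \<bar>r - t\<bar>" if "r \<ge> 0" for r x
      unfolding diffusion_def
      using \<open>t \<ge> 0\<close> that by (rule poisson_average_lipschitz[OF averaging_iterates(2)[OF f B]])
  qed (intro borel_measurable_diff diffusion_measurable)
  then have "continuous_Linf \<mu> (diffusion f)"
    unfolding continuous_Linf_def using diffusion_Linf by blast
  moreover have "has_Linf_derivative \<mu> (diffusion f) (nonlocal_op \<mu> s J (diffusion f t)) t"
    if "t > 0" for t
  proof -
    have "((\<lambda>r. Linf_norm \<mu> (\<lambda>x. (diffusion f r x - diffusion f t x) / (r - t)
        - nonlocal_op \<mu> s J (diffusion f t) x)) \<longlongrightarrow> 0) (at t within {0..})"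
    proof (rule Linf_norm_tendsto_0)
      show "(\<lambda>x. (diffusion f r x - diffusion f t x) / (r - t)
          - nonlocal_op \<mu> s J (diffusion f t) x) \<in> borel_measurable \<mu>" for r
        unfolding nonlocal_op_averaging
        using diffusion_measurable averaging_measurable[OF diffusion_measurable] by simp
      show "\<bar>(diffusion f r x - diffusion f t x) / (r - t)
          - nonlocal_op \<mu> s J (diffusion f t) x\<bar> \<le> 4 * B * \<bar>r - t\<bar>" if "r \<ge> 0" "r \<noteq> t" for r x
        unfolding nonlocal_op_diffusion unfolding diffusion_def
        using poisson_average_taylor[of "\<lambda>k. (averaging ^^ k) f x" B t r]
          averaging_iterates(2)[OF f B] \<open>t > 0\<close> that by simp
    qed
    moreover have "at t within {0..} = at t"
      using that by (intro at_within_interior) (simp add: interior_real_atLeast)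
    ultimately show ?thesis
      unfolding has_Linf_derivative_def by simp
  qed
  moreover have "diffusion f 0 x = f x" for x
    unfolding diffusion_def by simp
  ultimately show ?thesis
    unfolding cauchy_solution_def by simp
qed

lemma diffusion_space_time_norm:
  "Linf_norm (\<mu> \<Otimes>\<^sub>M restrict_space lborel {0<..}) (\<lambda>(x, t). diffusion f t x) \<le> ereal B"
proof (rule Linf_norm_le)
  have "(\<lambda>t. t) \<in> restrict_space lborel {0<..} \<rightarrow>\<^sub>M (borel :: real measure)"
    by (rule measurable_restrict_space1) simp
  then have "(\<lambda>p. (fst p, snd p)) \<in> \<mu> \<Otimes>\<^sub>M restrict_space (lborel :: real measure) {0<..} \<rightarrow>\<^sub>M \<mu> \<Otimes>\<^sub>M borel"
    by (intro measurable_Pair measurable_fst measurable_compose[OF measurable_snd])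
  from measurable_compose[OF this diffusion_pair_measurable[OF f B]]
  show "(\<lambda>(x, t). diffusion f t x) \<in> borel_measurable (\<mu> \<Otimes>\<^sub>M restrict_space lborel {0<..})"
    by (simp add: case_prod_beta)
  show "AE p in \<mu> \<Otimes>\<^sub>M restrict_space lborel {0<..}. \<bar>case p of (x, t) \<Rightarrow> diffusion f t x\<bar> \<le> B"
    by (rule AE_I2) (auto simp: space_pair_measure space_restrict_space intro!: diffusion_bound)
qed

end

section \<open>Uniqueness\<close>

text \<open>With \<open>w\<close> the difference and \<open>R\<close> the remainder of a difference
  quotient, \<open>w t\<close> equals \<open>w r\<close> plus \<open>t - r\<close> times the
  operator at \<open>w t\<close> and an error of norm at most \<open>q r\<close>. Evaluating the
  operator at \<open>t\<close> puts \<open>\<phi> t\<close> on the right; the 2 bounds averaging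
  minus identity.\<close>

lemma diffusion_difference_growth:
  assumes u: "continuous_Linf \<mu> u" "has_Linf_derivative \<mu> u (nonlocal_op \<mu> s J (u t)) t"
    and v: "continuous_Linf \<mu> v" "has_Linf_derivative \<mu> v (nonlocal_op \<mu> s J (v t)) t"
    and t: "t > 0"
  defines "\<phi> \<equiv> \<lambda>r. norm_Linf (\<lambda>x. v r x - u r x)"
  obtains q where "(q \<longlongrightarrow> 0) (at t)"
    and "\<And>r. r \<ge> 0 \<Longrightarrow> r \<noteq> t \<Longrightarrow> \<phi> t - \<phi> r \<le> \<bar>t - r\<bar> * (2 * \<phi> t + q r)"
proof -
  define R where "R = (\<lambda>u r x. (u r x - u t x) / (r - t) - nonlocal_op \<mu> s J (u t) x)"
  have uL: "u r \<in> Linf \<mu>" and vL: "v r \<in> Linf \<mu>" if "r \<ge> 0" for r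
    using u v that unfolding continuous_Linf_def by auto
  have RL: "R w r \<in> Linf \<mu>" if "w r \<in> Linf \<mu>" "w t \<in> Linf \<mu>" for w r
  proof -
    have "(\<lambda>x. (1 / (r - t)) * (w r x - w t x) + (- 1) * (averaging (w t) x - w t x)) \<in> Linf \<mu>"
      by (intro Linf_lincomb(1) Linf_diff(1) averaging_Linf(1) that)
    moreover have "R w r = (\<lambda>x. (1 / (r - t)) * (w r x - w t x) + (- 1) * (averaging (w t) x - w t x))"
      unfolding R_def nonlocal_op_averaging by auto
    ultimately show ?thesis by simp
  qed
  define q where "q = (\<lambda>r. norm_Linf (R v r) + norm_Linf (R u r))"
  have "((\<lambda>r. norm_Linf (R w r)) \<longlongrightarrow> 0) (at t)"
    if "has_Linf_derivative \<mu> w (nonlocal_op \<mu> s J (w t)) t" for w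
    using that lim_real_of_ereal[of "\<lambda>r. Linf_norm \<mu> (R w r)" 0 "at t"]
    unfolding has_Linf_derivative_def R_def by (simp add: zero_ereal_def)
  from tendsto_add[OF this[OF v(2)] this[OF u(2)]] have "(q \<longlongrightarrow> 0) (at t)"
    unfolding q_def by simp
  moreover have "\<phi> t - \<phi> r \<le> \<bar>t - r\<bar> * (2 * \<phi> t + q r)" if r: "r \<ge> 0" "r \<noteq> t" for r
  proof -
    define w where "w = (\<lambda>r x. v r x - u r x)"
    have w: "w r \<in> Linf \<mu>" "w t \<in> Linf \<mu>"
      unfolding w_def using Linf_diff(1) uL vL r t by auto
    have Rd: "R v r x - R u r x = (w r x - w t x) / (r - t) - (averaging (w t) x - w t x)" for x
      using averaging_diff[OF vL uL, of t t x] t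
      unfolding R_def w_def nonlocal_op_averaging by (simp add: diff_divide_distrib)
    have split: "w t x = w r x + (t - r) * ((averaging (w t) x - w t x) + (R v r x - R u r x))" for x
      unfolding Rd using r by (simp add: field_simps)
    have d: "(\<lambda>x. averaging (w t) x - w t x) \<in> Linf \<mu>"
      "norm_Linf (\<lambda>x. averaging (w t) x - w t x) \<le> 2 * norm_Linf (w t)"
      using Linf_diff[OF averaging_Linf(1)[OF w(2)] w(2)] averaging_Linf(2)[OF w(2)] by auto
    have e: "(\<lambda>x. R v r x - R u r x) \<in> Linf \<mu>" "norm_Linf (\<lambda>x. R v r x - R u r x) \<le> q r"
      using Linf_diff[OF RL RL, of v r u r] uL vL r t unfolding q_def by auto
    have g: "(\<lambda>x. (averaging (w t) x - w t x) + (R v r x - R u r x)) \<in> Linf \<mu>"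
      "norm_Linf (\<lambda>x. (averaging (w t) x - w t x) + (R v r x - R u r x)) \<le> 2 * norm_Linf (w t) + q r"
      using Linf_lincomb[OF d(1) e(1), of 1 1] d(2) e(2) by auto
    have "w t = (\<lambda>x. 1 * w r x + (t - r) * ((averaging (w t) x - w t x) + (R v r x - R u r x)))"
      by (rule ext, rule trans[OF split]) simp
    then have "norm_Linf (w t) \<le> norm_Linf (w r) + \<bar>t - r\<bar> *
        norm_Linf (\<lambda>x. (averaging (w t) x - w t x) + (R v r x - R u r x))"
      using Linf_lincomb(2)[OF w(1) g(1), of 1 "t - r"] by simp
    also have "\<dots> \<le> norm_Linf (w r) + \<bar>t - r\<bar> * (2 * norm_Linf (w t) + q r)"
      using g(2) by (simp add: mult_left_mono)
    finally show ?thesis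
      unfolding \<phi>_def w_def by simp
  qed
  ultimately show thesis by (rule that)
qed

lemma continuous_norm_Linf_diff:
  assumes "continuous_Linf \<mu> u" "continuous_Linf \<mu> v"
  shows "continuous_on {0..} (\<lambda>t. norm_Linf (\<lambda>x. v t x - u t x))"
  unfolding continuous_on_def
proof
  fix t :: real assume t: "t \<in> {0..}"
  have L: "u r \<in> Linf \<mu>" "v r \<in> Linf \<mu>" if "r \<ge> 0" for r
    using assms that unfolding continuous_Linf_def by auto
  define q where "q = (\<lambda>w r. norm_Linf (\<lambda>x. w r x - w t x :: real))"
  have q0: "(q w \<longlongrightarrow> 0) (at t within {0..})" if "continuous_Linf \<mu> w" for w
    using that t lim_real_of_ereal[of "\<lambda>r. Linf_norm \<mu> (\<lambda>x. w r x - w t x)" 0 "at t within {0..}"]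
    unfolding q_def continuous_Linf_def by (simp add: zero_ereal_def)
  have tri: "norm_Linf (\<lambda>x. v a x - u a x) \<le> norm_Linf (\<lambda>x. v b x - u b x)
      + (norm_Linf (\<lambda>x. v a x - v b x) + norm_Linf (\<lambda>x. u a x - u b x))"
    if "a \<ge> 0" "b \<ge> 0" for a b
  proof -
    have "(\<lambda>x. v a x - u a x) = (\<lambda>x. 1 * (v b x - u b x) + 1 * ((v a x - v b x) - (u a x - u b x)))"
      by auto
    then show ?thesis
      using Linf_lincomb(2)[of "\<lambda>x. v b x - u b x" "\<lambda>x. (v a x - v b x) - (u a x - u b x)" 1 1]
        Linf_diff[of "\<lambda>x. v a x - v b x" "\<lambda>x. u a x - u b x"] Linf_diff(1) L that
      by fastforce
  qed
  have sym: "norm_Linf (\<lambda>x. w a x - w b x) = norm_Linf (\<lambda>x. w b x - w a x)"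
    for w :: "real \<Rightarrow> 'a \<Rightarrow> real" and a b
  proof -
    have "(\<lambda>x. w a x - w b x) \<in> borel_measurable \<mu> \<longleftrightarrow> (\<lambda>x. w b x - w a x) \<in> borel_measurable \<mu>"
      using borel_measurable_uminus_eq[of "\<lambda>x. w a x - w b x" \<mu>] by simp
    then show ?thesis
      unfolding Linf_norm_def by (simp add: abs_minus_commute)
  qed
  have "\<bar>norm_Linf (\<lambda>x. v r x - u r x) - norm_Linf (\<lambda>x. v t x - u t x)\<bar> \<le> q v r + q u r"
    if "r \<ge> 0" for r
    using tri[of r t] tri[of t r] sym[of v r t] sym[of u r t] that t unfolding q_def
    by (auto simp: abs_le_iff)
  then have "\<forall>\<^sub>F r in at t within {0..}.
      norm (norm_Linf (\<lambda>x. v r x - u r x) - norm_Linf (\<lambda>x. v t x - u t x)) \<le> q v r + q u r"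
    by (auto simp: eventually_at_filter)
  moreover have "((\<lambda>r. q v r + q u r) \<longlongrightarrow> 0) (at t within {0..})"
    using tendsto_add[OF q0[OF assms(2)] q0[OF assms(1)]] by simp
  ultimately have "((\<lambda>r. norm_Linf (\<lambda>x. v r x - u r x) - norm_Linf (\<lambda>x. v t x - u t x)) \<longlongrightarrow> 0)
      (at t within {0..})"
    by (rule Lim_null_comparison)
  then show "((\<lambda>r. norm_Linf (\<lambda>x. v r x - u r x)) \<longlongrightarrow> norm_Linf (\<lambda>x. v t x - u t x))
      (at t within {0..})"
    by (rule Lim_null[THEN iffD2])
qed

text \<open>At the first time where the norm of the difference reaches the barrier
  \<open>b t = \<epsilon> * exp (3 * t)\<close>, the difference would have to grow at rate at least 3,
  but the equation only allows the rate 2.\<close>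

lemma diffusion_unique:
  assumes u: "cauchy_solution \<mu> s J f u" and v: "cauchy_solution \<mu> s J f v" and "t \<ge> 0"
  shows "AE x in \<mu>. v t x = u t x"
proof -
  define \<phi> where "\<phi> = (\<lambda>r. norm_Linf (\<lambda>x. v r x - u r x))"
  have uc: "continuous_Linf \<mu> u" and vc: "continuous_Linf \<mu> v"
    using u v unfolding cauchy_solution_def by auto
  have L: "(\<lambda>x. v r x - u r x) \<in> Linf \<mu>" if "r \<ge> 0" for r
    using uc vc that unfolding continuous_Linf_def by (simp add: Linf_diff(1))
  have cont: "continuous_on {0..} \<phi>"
    unfolding \<phi>_def by (rule continuous_norm_Linf_diff[OF uc vc])
  have nonneg: "\<phi> r \<ge> 0" for r
    unfolding \<phi>_def by (rule norm_Linf_nonneg)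
  have "AE x in \<mu>. u 0 x = f x" "AE x in \<mu>. v 0 x = f x"
    using u v unfolding cauchy_solution_def by auto
  then have "AE x in \<mu>. \<bar>v 0 x - u 0 x\<bar> \<le> 0"
    by eventually_elim simp
  then have "\<phi> 0 \<le> 0"
    unfolding \<phi>_def using L[of 0] by (intro norm_Linf_le) (auto simp: Linf_def)
  have "\<phi> t = 0"
  proof (rule ccontr)
    assume "\<phi> t \<noteq> 0"
    define b where "b = (\<lambda>r. \<phi> t * exp (3 * (r - t)))"
    have b_pos: "b r > 0" for r
      using \<open>\<phi> t \<noteq> 0\<close> nonneg[of t] unfolding b_def by simp
    define S where "S = {r \<in> {0..t}. b r \<le> \<phi> r}"
    have "continuous_on {0..t} (\<lambda>r. \<phi> r - b r)"
      unfolding b_def by (intro continuous_intros continuous_on_subset[OF cont]) auto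
    then have "closed ({0..t} \<inter> (\<lambda>r. \<phi> r - b r) -` {0..})"
      by (rule continuous_closed_preimage) auto
    moreover have "{0..t} \<inter> (\<lambda>r. \<phi> r - b r) -` {0..} = S"
      unfolding S_def by auto
    ultimately have "closed S" by simp
    moreover have "t \<in> S" "bdd_below S"
      unfolding S_def b_def using \<open>t \<ge> 0\<close> by auto
    ultimately have T: "Inf S \<in> S"
      by (intro closed_contains_Inf) auto
    define T where "T = Inf S"
    have "T \<in> S" using T unfolding T_def .
    have below: "\<phi> r < b r" if "0 \<le> r" "r < T" for r
      using cInf_lower[of r S] that \<open>bdd_below S\<close> \<open>T \<in> S\<close> unfolding T_def S_def
      by (metis (no_types, lifting) T_def atLeastAtMost_iff leD le_less_trans less_imp_le mem_Collect_eq
          not_le_imp_less S_def)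
    \<comment> \<open>At time 0 the barrier is positive while \<open>\<phi>\<close> vanishes, so
      there are times to the left of \<open>T\<close>.\<close>
    have "T > 0"
      using \<open>T \<in> S\<close> \<open>\<phi> 0 \<le> 0\<close> b_pos[of 0] unfolding S_def by (cases "T = 0") auto
    obtain q where q: "(q \<longlongrightarrow> 0) (at T)"
      "\<And>r. r \<ge> 0 \<Longrightarrow> r \<noteq> T \<Longrightarrow> \<phi> T - \<phi> r \<le> \<bar>T - r\<bar> * (2 * \<phi> T + q r)"
      using diffusion_difference_growth[OF uc _ vc _ \<open>T > 0\<close>] u v \<open>T > 0\<close>
      unfolding cauchy_solution_def \<phi>_def by blast
    have ev: "\<forall>\<^sub>F r in at_left T. 0 < r \<and> r < T"
      using \<open>T > 0\<close> by (auto simp: eventually_at_left_field)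
    have bd: "(b has_field_derivative 3 * b T) (at_left T)"
      unfolding b_def by (auto intro!: derivative_eq_intros)
    have "(\<phi> \<longlongrightarrow> \<phi> T) (at T)"
      using cont \<open>T > 0\<close> continuous_on_interior[of "{0..}" \<phi> T]
      by (simp add: interior_real_atLeast isCont_def)
    then have \<phi>T: "(\<phi> \<longlongrightarrow> \<phi> T) (at_left T)"
      by (rule filterlim_mono) (auto simp: at_le)
    have bT: "(b \<longlongrightarrow> b T) (at_left T)"
      using DERIV_continuous[OF bd] by (simp add: continuous_within)
    \<comment> \<open>With \<open>T \<in> S\<close> this means equality at \<open>T\<close>; it
      turns the rate \<open>2 * \<phi> T\<close> into at most \<open>2 * b T\<close>.\<close>
    have "\<phi> T \<le> b T"
      by (rule tendsto_le[OF _ bT \<phi>T])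
        (use ev below in \<open>auto elim!: eventually_mono simp: less_imp_le\<close>)
    have "3 * b T \<le> 2 * \<phi> T + 0"
    proof (rule tendsto_le)
      show "((\<lambda>r. (b r - b T) / (r - T)) \<longlongrightarrow> 3 * b T) (at_left T)"
        using bd by (simp add: has_field_derivative_iff)
      have "(q \<longlongrightarrow> 0) (at_left T)"
        using q(1) by (rule filterlim_mono) (auto simp: at_le)
      then show "((\<lambda>r. 2 * \<phi> T + q r) \<longlongrightarrow> 2 * \<phi> T + 0) (at_left T)"
        by (intro tendsto_intros)
      show "\<forall>\<^sub>F r in at_left T. (b r - b T) / (r - T) \<le> 2 * \<phi> T + q r"
        using ev
      proof eventually_elim
        case (elim r)
        \<comment> \<open>\<open>b\<close> lies above \<open>\<phi>\<close> at \<open>r\<close> and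
          not above it at \<open>T\<close>, so the increment of \<open>\<phi>\<close> dominates that
          of \<open>b\<close>, whose left difference quotients tend to
          \<open>3 * b T\<close>.\<close>
        have "b T - b r \<le> \<phi> T - \<phi> r"
          using below[of r] elim \<open>T \<in> S\<close> unfolding S_def by auto
        also have "\<dots> \<le> (T - r) * (2 * \<phi> T + q r)"
          using q(2)[of r] elim by simp
        finally have "(b T - b r) / (T - r) \<le> 2 * \<phi> T + q r"
          using elim by (simp add: pos_divide_le_eq mult.commute)
        then show ?case
          by (metis minus_diff_eq minus_divide_divide)
      qed
    qed simp
    with \<open>\<phi> T \<le> b T\<close> b_pos[of T] show False by linarith
  qed
  then show ?thesis
    using AE_le_norm_Linf[OF L[OF \<open>t \<ge> 0\<close>]] unfolding \<phi>_def by (auto elim!: eventually_mono)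
qed

end

section \<open>The Cauchy problem\<close>

text \<open>The isometry \<open>\<tau> x\<close> moves \<open>x\<close> to the base point, so the
  distance from \<open>x\<close> to \<open>y\<close> is that from \<open>\<tau> x y\<close> to the
  base point. The substitution \<open>z = \<tau> x y\<close> preserves the measure and reduces the
  mass of the kernel at \<open>x\<close> to the normalization.\<close>

lemma (in riemannian) nonlocal_diffusion_geodesic:
  assumes iso: "\<And>x. isometry A g (\<tau> x)" and \<tau>: "\<And>x. \<tau> x x = p\<^sub>0"
    and sets: "sets \<mu> = sets borel" and "sigma_finite_measure \<mu>"
    and inv: "\<And>x. distr \<mu> \<mu> (\<tau> x) = \<mu>"
    and J: "J \<in> borel_measurable (restrict_space borel {0..})" "\<And>r. r \<ge> 0 \<Longrightarrow> J r \<ge> 0"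
    and J1: "(LINT x|\<mu>. J (geodesic_dist A g x p\<^sub>0)) = 1"
  shows "nonlocal_diffusion \<mu> (geodesic_dist A g) J"
proof -
  interpret sigma_finite_measure \<mu> by fact
  \<comment> \<open>\<open>J\<close> is measurable only on the half-line, hence the distance is
    viewed as a map into the restricted space.\<close>
  have "(\<lambda>p. geodesic_dist A g (fst p) (snd p)) \<in> borel \<Otimes>\<^sub>M borel \<rightarrow>\<^sub>M restrict_space borel {0..}"
    using geodesic_dist_measurable geodesic_dist_nonneg
    by (intro measurable_restrict_space2) (auto simp: case_prod_beta)
  from measurable_compose[OF this J(1)]
  have meas: "(\<lambda>p. J (geodesic_dist A g (fst p) (snd p))) \<in> borel_measurable (\<mu> \<Otimes>\<^sub>M \<mu>)"
    using measurable_cong_sets[OF sets_pair_measure_cong[OF sets sets] refl] by blast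
  have space: "space \<mu> = UNIV"
    using sets_eq_imp_space_eq[OF sets] by simp
  have meas_p: "(\<lambda>z. J (geodesic_dist A g z p\<^sub>0)) \<in> borel_measurable \<mu>"
    using measurable_compose[OF _ meas, of "\<lambda>z. (z, p\<^sub>0)" \<mu>] space by simp
  have "(LINT y|\<mu>. J (geodesic_dist A g x y)) = 1" for x
  proof -
    have "continuous_on UNIV (\<tau> x)"
      using iso[of x] unfolding isometry_def smooth_map_def by blast
    then have "\<tau> x \<in> borel_measurable borel"
      by (rule borel_measurable_continuous_onI)
    then have \<tau>_meas: "\<tau> x \<in> measurable \<mu> \<mu>"
      using measurable_cong_sets[OF sets sets] by blast
    have "J (geodesic_dist A g x y) = J (geodesic_dist A g (\<tau> x y) p\<^sub>0)" for y
      using geodesic_dist_isometry[OF iso[of x], of x y] geodesic_dist_sym[of p\<^sub>0 "\<tau> x y"]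
      by (simp add: \<tau>)
    then have "(LINT y|\<mu>. J (geodesic_dist A g x y)) = (LINT z|distr \<mu> \<mu> (\<tau> x). J (geodesic_dist A g z p\<^sub>0))"
      by (simp add: integral_distr[OF \<tau>_meas meas_p])
    then show ?thesis using J1 by (simp add: inv)
  qed
  then show ?thesis
    using meas J(2) geodesic_dist_nonneg by unfold_locales (simp_all add: case_prod_beta)
qed

theorem theorem2p2:
  fixes A :: "('m::{t2_space, second_countable_topology}, 'e::euclidean_space) chart set"
    and g :: "('m, 'e) metric_tensor"
    and p\<^sub>0 :: 'm
    and \<tau> :: "'m \<Rightarrow> 'm \<Rightarrow> 'm"
    and \<mu> :: "'m measure"
    and J :: "real \<Rightarrow> real"
    and u\<^sub>0 :: "'m \<Rightarrow> real"
  assumes "riemannian_manifold A g"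
    and "\<And>x. isometry A g (\<tau> x)"
    and "\<And>x. \<tau> x x = p\<^sub>0"
    and "sets \<mu> = sets borel"
    and "sigma_finite_measure \<mu>"
    and "\<And>x. distr \<mu> \<mu> (\<tau> x) = \<mu>"
    and "J \<in> borel_measurable (restrict_space borel {0..})"
    and "\<And>r. r \<ge> 0 \<Longrightarrow> J r \<ge> 0"
    and "(LINT x|\<mu>. J (geodesic_dist A g x p\<^sub>0)) = 1"
    and "u\<^sub>0 \<in> Linf \<mu>"
  shows "\<exists>u. cauchy_solution \<mu> (geodesic_dist A g) J u\<^sub>0 u \<and>
           (\<forall>v. cauchy_solution \<mu> (geodesic_dist A g) J u\<^sub>0 v \<longrightarrow>
              (\<forall>t\<ge>0. AE x in \<mu>. v t x = u t x)) \<and>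
           Linf_norm (\<mu> \<Otimes>\<^sub>M restrict_space lborel {0<..}) (\<lambda>(x, t). u t x)
             \<le> Linf_norm \<mu> u\<^sub>0"
proof -
  interpret riemannian A g by unfold_locales fact
  interpret nonlocal_diffusion \<mu> "geodesic_dist A g" J
    by (rule nonlocal_diffusion_geodesic[of \<tau> p\<^sub>0]) fact+
  define B where "B = norm_Linf u\<^sub>0"
  \<comment> \<open>The representative bounded at every point. Changing the initial value on a null
    set leaves the problem unchanged, since the initial condition is imposed almost
    everywhere.\<close>
  define f where "f = (\<lambda>x. if \<bar>u\<^sub>0 x\<bar> \<le> B then u\<^sub>0 x else 0)"
  have B: "Linf_norm \<mu> u\<^sub>0 = ereal B" "B \<ge> 0"
    unfolding B_def using Linf_norm_real[OF assms(10)] norm_Linf_nonneg by auto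
  have f: "f \<in> borel_measurable \<mu>" "\<And>x. \<bar>f x\<bar> \<le> B"
    using assms(10) B(2) unfolding f_def Linf_def by auto
  have "AE x in \<mu>. f x = u\<^sub>0 x"
    using AE_le_norm_Linf[OF assms(10)] by eventually_elim (simp add: f_def B_def)
  then have "AE x in \<mu>. (v 0 x = f x) = (v 0 x = u\<^sub>0 x)" for v :: "real \<Rightarrow> 'm \<Rightarrow> real"
    by eventually_elim simp
  from eventually_subst[OF this] have "cauchy_solution \<mu> (geodesic_dist A g) J f v
      \<longleftrightarrow> cauchy_solution \<mu> (geodesic_dist A g) J u\<^sub>0 v" for v
    unfolding cauchy_solution_def by simp
  then show ?thesis
    using diffusion_solves[OF f] diffusion_unique diffusion_space_time_norm[OF f] B(1)
    by (intro exI[of _ "diffusion f"]) auto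
qed

end
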